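(* Let $n\ge 3$ and $q\ge 0$ be integers, let $\xi$ be real with $-1<\xi<1$, and let $\rho$ be a complex number such that $q<\Re\rho<q+1$. Let $$h(u)=-\left(1+2u\xi+u^2\right)^{-\frac{n-2}{2}}+\sum_{j=0}^{q}(-u)^j G_j^{\frac{n-2}{2}}(\xi),\qquad 0<u<\infty,$$ where $G_j^\lambda$ are the Gegenbauer polynomials, and let $M(h,\rho)=\int_0^\infty h(u)\,u^{-\rho-1}\,du$. Then $$M(h,\rho)=\frac{\pi\sqrt{\pi}\,2^{(3-n)/2}\,\prod_{k=1}^{n-3}(\rho+k)\,(1-\xi^2)^{(3-n)/4}}{\sin(\pi\rho)\;\Gamma\!\left(\frac{n-2}{2}\right)}\,P^{(3-n)/2}_{-\rho-(n-1)/2}(\xi),$$ and equivalently $$M(h,\rho)=\frac{\pi\,2^{(n-3)/2}\,\prod_{k=1}^{n-3}(\rho+k)\,\Gamma\!\left(\frac{n-1}{2}\right)(1-\xi^2)^{(3-n)/4}}{(n-3)!\,\sin(\pi\rho)}\,P^{(3-n)/2}_{-\rho-(n-1)/2}(\xi),$$ where $P^\mu_\nu(\xi)$ is the associated Legendre function of the first kind on the cut $(-1,1)$.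
   Context: $\Gamma$ is Euler's Gamma function. An empty product (the case $n=3$) equals $1$. Complex powers of positive real numbers are taken with the real logarithm. The Gegenbauer polynomials $G_j^\lambda(\xi)$, $j=0,1,2,\ldots$, are defined by the generating function $(1+2t\xi+t^2)^{-\lambda}=\sum_{j=0}^\infty(-t)^jG_j^\lambda(\xi)$ for $|t|<1$, $-1\le\xi\le1$. The associated Legendre function of the first kind on the cut, with complex parameters $\mu,\nu$, is the solution of $(1-\xi^2)y''-2\xi y'+[\nu(\nu+1)-\mu^2(1-\xi^2)^{-1}]y=0$ on $-1<\xi<1$ given by (Bateman–Erdélyi convention) $$P^\mu_\nu(\xi)=\frac{1}{\Gamma(1-\mu)}\left(\frac{1+\xi}{1-\xi}\right)^{\mu/2}{}_2F_1\!\left(-\nu,\nu+1;1-\mu;\frac{1-\xi}{2}\right),$$ where ${}_2F_1$ is the Gauss hypergeometric function. *)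

theory Defs
  imports "HOL-Complex_Analysis.Complex_Analysis"
begin

definition gegenbauer :: "real \<Rightarrow> nat \<Rightarrow> real \<Rightarrow> real" where
  "gegenbauer l j \<xi> =
     (THE g. \<forall>t. \<bar>t\<bar> < 1 \<longrightarrow> (\<lambda>i. (- t) ^ i * g i) sums ((1 + 2 * t * \<xi> + t\<^sup>2) powr (- l))) j"

text \<open>For \<open>-1 \<le> \<xi> \<le> 1\<close> the description above is satisfied by exactly one sequence.\<close>

lemma gegenbauer_ex1:
  fixes l \<xi> :: real
  assumes "- 1 \<le> \<xi>" "\<xi> \<le> 1"
  shows "\<exists>!g. \<forall>t. \<bar>t\<bar> < 1 \<longrightarrow> (\<lambda>i. (- t) ^ i * g i) sums ((1 + 2 * t * \<xi> + t\<^sup>2) powr (- l))"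
proof (rule ex_ex1I)
  define w where "w = Complex \<xi> (sqrt (1 - \<xi>\<^sup>2))"
  have le1: "\<xi>\<^sup>2 \<le> 1" using assms by (simp add: abs_square_le_1)
  have nw: "norm w = 1" using le1 by (simp add: w_def cmod_def)
  define f where "f z = exp (- of_real l * (Ln (1 + z * w) + Ln (1 + z * cnj w)))" for z
  have pos: "Re (1 + z * v) > 0" if "norm z < 1" "norm v = 1" for z v :: complex
  proof -
    have "\<bar>Re (z * v)\<bar> \<le> norm (z * v)" by (rule abs_Re_le_cmod)
    also have "\<dots> < 1" using that by (simp add: norm_mult)
    finally show ?thesis by simp
  qed
  have np: "1 + z * v \<notin> \<real>\<^sub>\<le>\<^sub>0" if "norm z < 1" "norm v = 1" for z v :: complex
    using pos[OF that] by (auto simp: complex_nonpos_Reals_iff)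
  have hol: "f holomorphic_on ball 0 1"
    unfolding f_def by (intro holomorphic_intros) (use np nw in auto)
  define c where "c i = (deriv ^^ i) f 0 / fact i" for i
  have val: "f (of_real t) = of_real ((1 + 2 * t * \<xi> + t\<^sup>2) powr (- l))" if "\<bar>t\<bar> < 1" for t
  proof -
    define a where "a = 1 + of_real t * w"
    have ap: "Re a > 0" unfolding a_def using that nw by (intro pos) auto
    have ca: "1 + of_real t * cnj w = cnj a" by (simp add: a_def)
    have a0: "a \<noteq> 0" using ap by auto
    have "Ln (cnj a) = cnj (Ln a)"
      using ap by (intro cnj_Ln[symmetric]) (auto simp: complex_nonpos_Reals_iff)
    then have "Ln a + Ln (cnj a) = of_real (2 * Re (Ln a))" by (simp add: complex_add_cnj)
    also have "2 * Re (Ln a) = ln ((cmod a)\<^sup>2)" using a0 by (simp add: Re_Ln ln_realpow)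
    finally have L: "Ln a + Ln (cnj a) = of_real (ln ((cmod a)\<^sup>2))" .
    have n: "(cmod a)\<^sup>2 = 1 + 2 * t * \<xi> + t\<^sup>2"
    proof -
      have "(cmod a)\<^sup>2 = (1 + t * \<xi>)\<^sup>2 + t\<^sup>2 * (1 - \<xi>\<^sup>2)"
        using le1 by (simp add: cmod_power2 a_def w_def power_mult_distrib)
      then show ?thesis by (simp add: algebra_simps power2_eq_square)
    qed
    have "(cmod a)\<^sup>2 \<noteq> 0" using a0 by simp
    then have "of_real (((cmod a)\<^sup>2) powr (- l)) = exp (- of_real l * (complex_of_real (ln ((cmod a)\<^sup>2))))"
      by (simp add: powr_def flip: exp_of_real)
    then show ?thesis unfolding f_def ca a_def[symmetric] L by (simp add: n)
  qed
  show "\<exists>g. \<forall>t. \<bar>t\<bar> < 1 \<longrightarrow> (\<lambda>i. (- t) ^ i * g i) sums ((1 + 2 * t * \<xi> + t\<^sup>2) powr (- l))"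
  proof (intro exI allI impI)
    fix t :: real assume t: "\<bar>t\<bar> < 1"
    have "(\<lambda>i. c i * of_real t ^ i) sums f (of_real t)"
      using holomorphic_power_series[OF hol, of "of_real t"] t by (simp add: c_def)
    then have "(\<lambda>i. Re (c i * of_real t ^ i)) sums Re (f (of_real t))" by (rule sums_Re)
    moreover have "(\<lambda>i. Re (c i * of_real t ^ i)) = (\<lambda>i. (- t) ^ i * ((- 1) ^ i * Re (c i)))"
      by (rule ext) (simp flip: of_real_power add: power_minus[of t])
    ultimately show "(\<lambda>i. (- t) ^ i * ((- 1) ^ i * Re (c i))) sums ((1 + 2 * t * \<xi> + t\<^sup>2) powr (- l))"
      unfolding val[OF t] by (simp only: Re_complex_of_real)
  qed
next
  fix g g' :: "nat \<Rightarrow> real"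
  let ?F = "\<lambda>t. (1 + 2 * t * \<xi> + t\<^sup>2) powr (- l)"
  assume g: "\<forall>t. \<bar>t\<bar> < 1 \<longrightarrow> (\<lambda>i. (- t) ^ i * g i) sums ?F t"
    and g': "\<forall>t. \<bar>t\<bar> < 1 \<longrightarrow> (\<lambda>i. (- t) ^ i * g' i) sums ?F t"
  have S: "(\<lambda>i. (g i - g' i) * s ^ i) sums 0" if "norm s < 1" for s
    using sums_diff[OF g[rule_format, of "- s"] g'[rule_format, of "- s"]] that
    by (simp add: algebra_simps)
  have "g i - g' i = 0" for i
  proof (cases "i = 0")
    case True
    then show ?thesis using S[of 0] by simp
  next
    case False
    show ?thesis
    proof (rule ccontr)
      assume nz: "g i - g' i \<noteq> 0"
      show False
      proof (rule powser_0_nonzero[of 1 0 "\<lambda>i. g i - g' i" "\<lambda>_. 0" i])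
        show "(\<lambda>n. (g n - g' n) * (x - 0) ^ n) sums 0" if "norm (x - 0) < 1" for x
          using S[of x] that by simp
      next
        fix s :: real
        assume s: "0 < s" "\<And>z. z \<in> cball (0::real) s - {0} \<Longrightarrow> (0::real) \<noteq> 0"
        have "s \<in> cball 0 s - {0}" using s(1) by (simp add: dist_norm)
        then show False using s(2) by blast
      qed (use nz False in simp_all)
    qed
  qed
  then show "g = g'" by auto
qed

lemma gegenbauer_sums:
  assumes "- 1 \<le> \<xi>" "\<xi> \<le> 1" "\<bar>t\<bar> < 1"
  shows "(\<lambda>j. (- t) ^ j * gegenbauer l j \<xi>) sums ((1 + 2 * t * \<xi> + t\<^sup>2) powr (- l))"
  using theI'[OF gegenbauer_ex1[OF assms(1,2), of l]] assms(3) unfolding gegenbauer_def by blast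

text \<open>The Gauss series; it represents the hypergeometric function for \<open>\<bar>z\<bar> < 1\<close> and
  \<open>c \<notin> {0, -1, -2, \<dots>}\<close>.\<close>

definition hyp2F1 :: "complex \<Rightarrow> complex \<Rightarrow> complex \<Rightarrow> complex \<Rightarrow> complex" where
  "hyp2F1 a b c z =
     (\<Sum>k. pochhammer a k * pochhammer b k / (pochhammer c k * fact k) * z ^ k)"

text \<open>Ferrers function \<open>P\<^sup>\<mu>\<^sub>\<nu>(\<xi>)\<close> for \<open>-1 < \<xi> < 1\<close> and \<open>\<mu> \<notin> {1, 2, \<dots>}\<close>; at a positive
  integer \<open>\<mu>\<close> the quotient by \<open>\<Gamma>(1 - \<mu>)\<close> would have to be read as a limit, which
  is not done here.\<close>

definition legendre_P_cut :: "complex \<Rightarrow> complex \<Rightarrow> real \<Rightarrow> complex" where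
  "legendre_P_cut \<mu> \<nu> \<xi> =
     1 / Gamma (1 - \<mu>) * of_real ((1 + \<xi>) / (1 - \<xi>)) powr (\<mu> / 2)
       * hyp2F1 (- \<nu>) (\<nu> + 1) (1 - \<mu>) (of_real ((1 - \<xi>) / 2))"

definition h_fun :: "nat \<Rightarrow> nat \<Rightarrow> real \<Rightarrow> real \<Rightarrow> real" where
  "h_fun n q \<xi> u =
     - ((1 + 2 * u * \<xi> + u\<^sup>2) powr (- ((real n - 2) / 2)))
     + (\<Sum>j=0..q. (- u) ^ j * gegenbauer ((real n - 2) / 2) j \<xi>)"

text \<open>Note the exponent \<open>-\<rho> - 1\<close>, so this is the usual Mellin transform at \<open>-\<rho>\<close>.\<close>

definition mellin_integrand :: "(real \<Rightarrow> real) \<Rightarrow> complex \<Rightarrow> real \<Rightarrow> complex" where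
  "mellin_integrand h \<rho> u = of_real (h u) * of_real u powr (- \<rho> - 1)"

definition mellin_M :: "(real \<Rightarrow> real) \<Rightarrow> complex \<Rightarrow> complex" where
  "mellin_M h \<rho> = (LINT u:{0<..}|lborel. mellin_integrand h \<rho> u)"

end

(*
  Put s = -rho, l = (n - 2)/2 and z = (1 - xi)/2. Since
  1 + 2 u xi + u^2 = (1 + u)^2 (1 - 4 z u / (1 + u)^2), the binomial series gives
    (1 + 2 u xi + u^2)^(-l) = sum_k (l)_k / k! (4 z)^k u^k (1 + u)^(-2 l - 2 k).
  The k-th summand is O(u^k), so only the finitely many summands with k <= q are changed when the
  Taylor polynomial of degree q (the Gegenbauer sum) is subtracted. The Mellin transform of
  (1 + u)^(-p) is Beta(w, p - w), and it keeps this value on the strip -N < Re w < 1 - N once the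
  first N Taylor terms are subtracted; as p is a positive integer this follows by induction from an
  algebraic recurrence, without analytic continuation. Summing the Beta values gives
  Beta(s, 2 l - s) 2F1(s, 2 l - s; l + 1/2; z), and Euler's transformation of 2F1 turns this into
  the Legendre function.
*)
theory Submission
  imports Defs
begin

section \<open>The Gauss hypergeometric series\<close>

text \<open>Formal series, so that the differential equation becomes coefficient algebra;
  convergence is treated separately.\<close>

definition hyp2F1_fps :: "complex \<Rightarrow> complex \<Rightarrow> complex \<Rightarrow> complex fps" where
  "hyp2F1_fps a b c = Abs_fps (\<lambda>k. pochhammer a k * pochhammer b k / (pochhammer c k * fact k))"

text \<open>The operator of Gauss's hypergeometric differential equation.\<close>

definition hyp2F1_op :: "complex \<Rightarrow> complex \<Rightarrow> complex \<Rightarrow> complex fps \<Rightarrow> complex fps" where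
  "hyp2F1_op a b c G = fps_X * (1 - fps_X) * fps_deriv (fps_deriv G)
     + (fps_const c - (fps_const a + fps_const b + 1) * fps_X) * fps_deriv G
     - fps_const a * fps_const b * G"

text \<open>The second-derivative term and the term with \<open>c\<close> combine to (k + 1) (k +
  c), while k (k - 1) + (a + b + 1) k + a b factors as (k + a) (k + b). The differential equation is
  thus a two-term recurrence.\<close>

lemma hyp2F1_op_nth:
  "hyp2F1_op a b c G $ k = (of_nat k + 1) * (of_nat k + c) * G $ Suc k
     - (of_nat k + a) * (of_nat k + b) * G $ k"
proof -
  have "hyp2F1_op a b c G = fps_X * fps_deriv (fps_deriv G)
      - fps_X * (fps_X * fps_deriv (fps_deriv G)) + fps_const c * fps_deriv G
      - fps_const (a + b + 1) * (fps_X * fps_deriv G) - fps_const (a * b) * G"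
    unfolding hyp2F1_op_def fps_const_add[symmetric] fps_const_mult[symmetric] fps_const_1_eq_1
    by algebra
  then have eq: "hyp2F1_op a b c G $ k = (fps_X * fps_deriv (fps_deriv G)) $ k
      - (fps_X * (fps_X * fps_deriv (fps_deriv G))) $ k + c * fps_deriv G $ k
      - (a + b + 1) * (fps_X * fps_deriv G) $ k - a * b * G $ k"
    by simp
  show ?thesis
  proof (cases k)
    case (Suc m)
    \<comment> \<open>One term carries two factors \<open>fps_X\<close>, so index 1 needs a case of
      its own.\<close>
    then show ?thesis unfolding eq by (cases m) (simp_all add: algebra_simps)
  next
    case 0
    then show ?thesis unfolding eq by (simp add: algebra_simps)
  qed
qed

text \<open>The factor (k + 1) (k + c) never vanishes, so the recurrence determines all coefficients
  from \<open>G $ 0\<close>. A series in the kernel can be identified by its constant term.\<close>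

lemma hyp2F1_op_eq_0_iff:
  assumes "c \<notin> \<int>\<^sub>\<le>\<^sub>0"
  shows "hyp2F1_op a b c G = 0 \<longleftrightarrow> G = fps_const (G $ 0) * hyp2F1_fps a b c"
proof -
  have nz: "(of_nat k + 1) * (of_nat k + c) \<noteq> 0" for k
  proof -
    have "c + of_nat k \<noteq> 0"
      using assms eq_neg_iff_add_eq_0[of c "of_nat k"] by auto
    moreover have "(1 :: complex) + of_nat k \<noteq> 0"
      using of_nat_neq_0[of k, where ?'a = complex] by simp
    ultimately show ?thesis by (simp add: add.commute)
  qed
  have "D * x - N * y = 0 \<longleftrightarrow> x = N / D * y" if "D \<noteq> 0" for D N x y :: complex
    using that by (auto simp: field_simps)
  from this[OF nz] have "hyp2F1_op a b c G = 0 \<longleftrightarrow>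
     (\<forall>k. G $ Suc k = (of_nat k + a) * (of_nat k + b) / ((of_nat k + 1) * (of_nat k + c)) * G $ k)"
    unfolding fps_eq_iff hyp2F1_op_nth fps_zero_nth by (intro all_cong1)
  also have "\<dots> \<longleftrightarrow> (\<forall>k. G $ k = G $ 0 * hyp2F1_fps a b c $ k)"
  proof -
    have rec: "hyp2F1_fps a b c $ Suc k =
       (of_nat k + a) * (of_nat k + b) / ((of_nat k + 1) * (of_nat k + c)) * hyp2F1_fps a b c $ k" for k
      by (simp only: hyp2F1_fps_def fps_nth_Abs_fps pochhammer_Suc fact_Suc of_nat_Suc
            of_nat_mult times_divide_times_eq ac_simps)
    show ?thesis
    proof safe
      fix k
      assume G: "\<forall>k. G $ Suc k = (of_nat k + a) * (of_nat k + b) / ((of_nat k + 1) * (of_nat k + c)) * G $ k"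
      show "G $ k = G $ 0 * hyp2F1_fps a b c $ k"
      proof (induction k)
        case 0
        then show ?case by (simp add: hyp2F1_fps_def)
      next
        case (Suc k)
        then show ?case unfolding rec G[rule_format, of k] by simp
      qed
    next
      fix k
      assume G: "\<forall>k. G $ k = G $ 0 * hyp2F1_fps a b c $ k"
      show "G $ Suc k = (of_nat k + a) * (of_nat k + b) / ((of_nat k + 1) * (of_nat k + c)) * G $ k"
        unfolding G[rule_format, of "Suc k"] G[rule_format, of k] rec by simp
    qed
  qed
  finally show ?thesis by (simp add: fps_eq_iff)
qed

text \<open>Ratio test: the quotient of successive coefficients, (a + k) (b + k) / ((c + k) (1 +
  k)), tends to 1.\<close>

lemma fps_conv_radius_hyp2F1_fps:
  assumes "c \<notin> \<int>\<^sub>\<le>\<^sub>0"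
  shows "fps_conv_radius (hyp2F1_fps a b c) \<ge> 1"
proof -
  let ?f = "\<lambda>k. hyp2F1_fps a b c $ k"
  have quot: "(\<lambda>k. (x + of_nat k) / (y + of_nat k) :: complex) \<longlonglongrightarrow> 1" for x y
  proof -
    have "(\<lambda>k. (x / of_nat k + 1) / (y / of_nat k + 1)) \<longlonglongrightarrow> (0 + 1) / (0 + 1 :: complex)"
      by (intro tendsto_intros lim_const_over_n) auto
    moreover have "\<forall>\<^sub>F k in sequentially.
        (x / of_nat k + 1) / (y / of_nat k + 1) = (x + of_nat k) / (y + of_nat k)"
      using eventually_gt_at_top[of 0]
    proof eventually_elim
      case (elim k)
      then have "(x / of_nat k + 1) = (x + of_nat k) / of_nat k"
                "(y / of_nat k + 1) = (y + of_nat k) / of_nat k"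
        by (simp_all add: field_simps)
      then show ?case using elim by simp
    qed
    ultimately show ?thesis by (simp add: tendsto_cong)
  qed
  have rec: "?f (Suc k) = ((a + of_nat k) / (c + of_nat k)) * ((b + of_nat k) / (1 + of_nat k)) * ?f k" for k
    by (simp only: hyp2F1_fps_def fps_nth_Abs_fps pochhammer_Suc fact_Suc of_nat_Suc
          of_nat_mult times_divide_times_eq ac_simps)
  have "conv_radius ?f \<ge> 1"
  proof (rule conv_radius_geI_ex')
    fix r :: real assume r: "0 < r" "ereal r < 1"
    let ?q = "\<lambda>k. norm (((a + of_nat k) / (c + of_nat k)) * ((b + of_nat k) / (1 + of_nat k))) * r"
    have "?q \<longlonglongrightarrow> norm (1 * 1 :: complex) * r"
      by (intro tendsto_intros quot)
    then have "\<forall>\<^sub>F k in sequentially. ?q k < (1 + r) / 2"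
      by (rule order_tendstoD) (use r in simp)
    then obtain N where N: "\<And>k. k \<ge> N \<Longrightarrow> ?q k < (1 + r) / 2"
      by (auto simp: eventually_at_top_linorder)
    show "summable (\<lambda>k. ?f k * of_real r ^ k)"
    proof (rule summable_ratio_test[of "(1 + r) / 2" N])
      fix k assume "k \<ge> N"
      have "norm (?f (Suc k) * of_real r ^ Suc k) = ?q k * norm (?f k * of_real r ^ k)"
        using r by (simp add: rec norm_mult norm_power norm_divide)
      also have "\<dots> \<le> (1 + r) / 2 * norm (?f k * of_real r ^ k)"
        using N[OF \<open>k \<ge> N\<close>] by (intro mult_right_mono) auto
      finally show "norm (?f (Suc k) * of_real r ^ Suc k) \<le> (1 + r) / 2 * norm (?f k * of_real r ^ k)" .
    qed (use r in simp)
  qed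
  then show ?thesis by (simp add: fps_conv_radius_def)
qed

lemma hyp2F1_sums:
  assumes "c \<notin> \<int>\<^sub>\<le>\<^sub>0" "norm z < 1"
  shows "(\<lambda>k. pochhammer a k * pochhammer b k / (pochhammer c k * fact k) * z ^ k) sums hyp2F1 a b c z"
proof -
  have "ereal (norm z) < fps_conv_radius (hyp2F1_fps a b c)"
    by (rule less_le_trans[OF _ fps_conv_radius_hyp2F1_fps[OF assms(1)]]) (use assms(2) in simp)
  from summable_fps[OF this] show ?thesis
    unfolding hyp2F1_def by (simp add: hyp2F1_fps_def summable_sums)
qed

lemma hyp2F1_conv_eval_fps: "hyp2F1 a b c z = eval_fps (hyp2F1_fps a b c) z"
  by (simp add: hyp2F1_def eval_fps_def hyp2F1_fps_def)

lemma pochhammer_fact_sums: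
  fixes z :: complex
  assumes "norm z < 1"
  shows "(\<lambda>k. pochhammer \<alpha> k / fact k * z ^ k) sums ((1 - z) powr (- \<alpha>))"
proof -
  have "(\<lambda>k. ((- \<alpha>) gchoose k) * (- z) ^ k) sums (1 + (- z)) powr (- \<alpha>)"
    by (rule gen_binomial_complex) (use assms in simp)
  also have "(\<lambda>k. ((- \<alpha>) gchoose k) * (- z) ^ k) = (\<lambda>k. pochhammer \<alpha> k / fact k * z ^ k)"
  proof
    fix k show "((- \<alpha>) gchoose k) * (- z) ^ k = pochhammer \<alpha> k / fact k * z ^ k"
      by (cases "even k") (simp_all add: gbinomial_pochhammer)
  qed
  finally show ?thesis by simp
qed

text \<open>\<open>(1 - X)\<close> to the power \<open>c - a - b\<close> times the series on the right is annihilated by the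
  hypergeometric operator of the left-hand side.\<close>

lemma hyp2F1_Euler:
  assumes c: "c \<notin> \<int>\<^sub>\<le>\<^sub>0" and z: "norm z < 1"
  shows "hyp2F1 a b c z = (1 - z) powr (c - a - b) * hyp2F1 (c - a) (c - b) c z"
proof -
  define \<alpha> where "\<alpha> = a + b - c"
  define P where "P = Abs_fps (\<lambda>k. pochhammer \<alpha> k / fact k)"
  define F where "F = hyp2F1_fps (c - a) (c - b) c"
  \<comment> \<open>\<open>P\<close> is the binomial series of (1 - X) to the power -\<alpha> = c -
    a - b. \<open>P1\<close> is its first-order differential equation, \<open>P2\<close> the
    derivative of that.\<close>
  have P1: "(1 - fps_X) * fps_deriv P = fps_const \<alpha> * P"
  proof (rule fps_ext)
    fix k
    have "P $ Suc k * of_nat (Suc k) = (\<alpha> + of_nat k) * P $ k"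
      by (simp add: P_def pochhammer_Suc del: of_nat_Suc)
    then show "((1 - fps_X) * fps_deriv P) $ k = (fps_const \<alpha> * P) $ k"
      by (cases k) (simp_all add: algebra_simps)
  qed
  have P2: "(1 - fps_X) * fps_deriv (fps_deriv P) = (fps_const \<alpha> + 1) * fps_deriv P"
    using arg_cong[OF P1, of fps_deriv] by (simp add: algebra_simps)
  have F0: "hyp2F1_op (c - a) (c - b) c F = 0"
    using hyp2F1_op_eq_0_iff[OF c] by (simp add: F_def hyp2F1_fps_def)
  have "hyp2F1_op a b c (P * F) = 0"
  proof -
    have \<alpha>: "fps_const \<alpha> = fps_const a + fps_const b - fps_const c"
      by (simp add: \<alpha>_def)
    \<comment> \<open>Leibniz expansion, regrouped so that each summand contains one of the
      expressions that \<open>F0\<close>, \<open>P1\<close> and \<open>P2\<close> make zero.\<close>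
    have "hyp2F1_op a b c (P * F) = P * hyp2F1_op (c - a) (c - b) c F
       + fps_X * F * ((1 - fps_X) * fps_deriv (fps_deriv P) - (fps_const \<alpha> + 1) * fps_deriv P)
       + (2 * fps_X * fps_deriv F + fps_const c * F) * ((1 - fps_X) * fps_deriv P - fps_const \<alpha> * P)"
      unfolding \<alpha> hyp2F1_op_def fps_const_sub[symmetric]
      by (simp only: fps_deriv_mult fps_deriv_add) algebra
    then show ?thesis by (simp add: F0 P1 P2)
  qed
  \<comment> \<open>The kernel is one-dimensional, so the constant term 1 identifies the
    product.\<close>
  moreover have "(P * F) $ 0 = 1"
    by (simp add: P_def F_def hyp2F1_fps_def)
  ultimately have PF: "P * F = hyp2F1_fps a b c"
    using hyp2F1_op_eq_0_iff[OF c, of a b "P * F"] by (simp del: fps_mult_nth_0)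
  have "fps_conv_radius P \<ge> 1"
  proof -
    have "conv_radius (fps_nth P) \<ge> 1"
    proof (rule conv_radius_geI_ex')
      fix r :: real assume "0 < r" "ereal r < 1"
      then show "summable (\<lambda>k. P $ k * of_real r ^ k)"
        using pochhammer_fact_sums[of "of_real r" \<alpha>] by (auto simp: P_def sums_iff)
    qed
    then show ?thesis by (simp add: fps_conv_radius_def)
  qed
  moreover have "fps_conv_radius F \<ge> 1"
    unfolding F_def by (rule fps_conv_radius_hyp2F1_fps[OF c])
  moreover have "ereal (norm z) < 1"
    using z by simp
  ultimately have "eval_fps (P * F) z = eval_fps P z * eval_fps F z"
    by (intro eval_fps_mult) (blast intro: less_le_trans)+
  moreover have "eval_fps P z = (1 - z) powr (c - a - b)"
    using pochhammer_fact_sums[OF z, of \<alpha>] by (simp add: eval_fps_def P_def sums_iff \<alpha>_def algebra_simps)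
  ultimately show ?thesis
    unfolding hyp2F1_conv_eval_fps F_def[symmetric] PF[symmetric] by (simp only:)
qed

section \<open>Mellin transforms\<close>

lemma borel_measurable_indicator_powr:
  "(\<lambda>u::real. indicator {0<..} u *\<^sub>R (complex_of_real u powr z)) \<in> borel_measurable borel"
  by (intro borel_measurable_continuous_on_indicator continuous_intros)
     (auto simp: complex_nonpos_Reals_iff)

text \<open>Euler's integral over \<open>lborel\<close>: absolute integrability for the completed
  measure passes to it because the integrand is Borel measurable.\<close>

lemma has_bochner_integral_Gamma:
  assumes "Re z > 0"
  shows "has_bochner_integral lborel
           (\<lambda>t. indicator {0<..} t *\<^sub>R (complex_of_real t powr (z - 1) / of_real (exp t))) (Gamma z)"
proof -
  let ?f = "\<lambda>t. complex_of_real t powr (z - 1) / of_real (exp t)"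
  have "(\<lambda>t. indicator {0<..} t *\<^sub>R ?f t) \<in> borel_measurable borel"
    by (intro borel_measurable_continuous_on_indicator continuous_intros)
       (auto simp: complex_nonpos_Reals_iff)
  then have int: "set_integrable lborel {0<..} ?f"
    using absolutely_integrable_Gamma_integral'[OF assms]
    unfolding set_integrable_def by (subst (asm) integrable_completion) auto
  have "(LINT t:{0<..}|lborel. ?f t) = Gamma z"
    using set_borel_integral_eq_integral(2)[OF int] Gamma_integral_complex'[OF assms]
    by (simp add: integral_unique)
  then show ?thesis
    using int by (simp add: has_bochner_integral_iff set_integrable_def set_lebesgue_integral_def)
qed

lemma has_bochner_integral_Gamma_scaled:
  assumes "Re z > 0" "a > 0"
  shows "has_bochner_integral lborel
           (\<lambda>t. indicator {0<..} t *\<^sub>R (complex_of_real t powr (z - 1) / of_real (exp (a * t))))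
           (Gamma z / of_real a powr z)"
proof -
  have "has_bochner_integral lborel
          (\<lambda>t. indicator {0<..} (0 + a * t) *\<^sub>R
                 (complex_of_real (0 + a * t) powr (z - 1) / of_real (exp (0 + a * t))))
          (Gamma z /\<^sub>R \<bar>a\<bar>)"
    using assms by (subst lborel_has_bochner_integral_real_affine_iff[symmetric])
                   (auto intro!: has_bochner_integral_Gamma)
  then have "has_bochner_integral lborel
          (\<lambda>t. 1 / of_real a powr (z - 1) * (indicator {0<..} (0 + a * t) *\<^sub>R
                 (complex_of_real (0 + a * t) powr (z - 1) / of_real (exp (0 + a * t)))))
          (1 / of_real a powr (z - 1) * (Gamma z /\<^sub>R \<bar>a\<bar>))"
    by (rule has_bochner_integral_mult_right)
  also have "(\<lambda>t. 1 / of_real a powr (z - 1) * (indicator {0<..} (0 + a * t) *\<^sub>R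
                 (complex_of_real (0 + a * t) powr (z - 1) / of_real (exp (0 + a * t))))) =
             (\<lambda>t. indicator {0<..} t *\<^sub>R (complex_of_real t powr (z - 1) / of_real (exp (a * t))))"
    using assms(2) by (auto simp: fun_eq_iff indicator_def zero_less_mult_iff powr_times_real)
  also have "1 / of_real a powr (z - 1) * (Gamma z /\<^sub>R \<bar>a\<bar>) = Gamma z / of_real a powr z"
    using assms(2) by (simp add: powr_diff scaleR_conv_of_real field_simps)
  finally show ?thesis .
qed

text \<open>The norm of a complex power of t > 0 depends only on the real part of the exponent, so
  this is the scaled Gamma integral at a real parameter. It serves the absolute integrability in
  Fubini's theorem.\<close>

lemma has_bochner_integral_norm_Gamma_scaled:
  assumes "Re z > 0" "a > 0"
  shows "has_bochner_integral lborel
           (\<lambda>t. norm (indicator {0<..} t *\<^sub>R (complex_of_real t powr (z - 1) / of_real (exp (a * t)))))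
           (Gamma (Re z) / a powr Re z)"
proof -
  have "has_bochner_integral lborel
     (\<lambda>t. Re (indicator {0<..} t *\<^sub>R (complex_of_real t powr (of_real (Re z) - 1) / of_real (exp (a * t)))))
     (Re (Gamma (of_real (Re z)) / of_real a powr of_real (Re z)))"
    by (intro has_bochner_integral_bounded_linear[OF bounded_linear_Re]
          has_bochner_integral_Gamma_scaled) (use assms in auto)
  also have "(\<lambda>t. Re (indicator {0<..} t *\<^sub>R (complex_of_real t powr (of_real (Re z) - 1) / of_real (exp (a * t))))) =
     (\<lambda>t. norm (indicator {0<..} t *\<^sub>R (complex_of_real t powr (z - 1) / of_real (exp (a * t)))))"
  proof
    fix t :: real
    show "Re (indicator {0<..} t *\<^sub>R (complex_of_real t powr (of_real (Re z) - 1) / of_real (exp (a * t)))) =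
     norm (indicator {0<..} t *\<^sub>R (complex_of_real t powr (z - 1) / of_real (exp (a * t))))"
    proof (cases "t > 0")
      case True
      then have "complex_of_real t powr (of_real (Re z) - 1) = of_real (t powr (Re z - 1))"
        by (simp flip: powr_of_real)
      with True show ?thesis by (simp add: norm_divide norm_powr_real_powr)
    qed auto
  qed
  also have "Re (Gamma (of_real (Re z)) / of_real a powr of_real (Re z)) = Gamma (Re z) / a powr Re z"
    using assms(2) by (simp add: Gamma_complex_of_real powr_of_real)
  finally show ?thesis .
qed

text \<open>The kernel u^(w - 1) t^(p - 1) exp (- t (1 + u)) is integrated in both orders. Over u it
  gives Gamma w times t^(p - w - 1) exp (- t), whose integral is Gamma (p - w); over t it gives
  Gamma p times the integrand in question. Fubini equates the two.\<close>

lemma has_bochner_integral_Beta: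
  fixes w p :: complex
  assumes w: "Re w > 0" "Re w < Re p"
  shows "has_bochner_integral lborel
           (\<lambda>u. indicator {0<..} u *\<^sub>R (complex_of_real u powr (w - 1) / of_real (1 + u) powr p))
           (Beta w (p - w))"
proof -
  define A where "A u = indicator {0<..} u *\<^sub>R (complex_of_real u powr (w - 1))" for u
  define B where "B t = indicator {0<..} t *\<^sub>R (complex_of_real t powr (p - 1))" for t
  define K where "K = (\<lambda>t u. A u * B t * of_real (exp (- t * (1 + u))))"
  have [measurable]: "A \<in> borel_measurable borel" "B \<in> borel_measurable borel"
    unfolding A_def B_def by (intro borel_measurable_indicator_powr)+
  have meas: "case_prod K \<in> borel_measurable (lborel \<Otimes>\<^sub>M lborel)"
    unfolding K_def by measurable
  have K1: "K t u = (B t * of_real (exp (- t))) *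
      (indicator {0<..} u *\<^sub>R (complex_of_real u powr (w - 1) / of_real (exp (t * u))))" for t u
    unfolding K_def A_def by (simp add: indicator_def exp_minus exp_add ring_distribs field_simps exp_diff)
  have K2: "K t u = A u *
      (indicator {0<..} t *\<^sub>R (complex_of_real t powr (p - 1) / of_real (exp ((1 + u) * t))))" for t u
  proof -
    have "exp (- t * (1 + u)) = inverse (exp ((1 + u) * t))"
      by (simp add: exp_minus[symmetric] mult.commute)
    then show ?thesis
      unfolding K_def B_def by (simp add: indicator_def divide_inverse)
  qed
  have intu: "has_bochner_integral lborel (K t)
     (Gamma w * (indicator {0<..} t *\<^sub>R (complex_of_real t powr (p - w - 1) / of_real (exp t))))" for t
  proof (cases "t > 0")
    case True
    have "has_bochner_integral lborel (K t) ((B t * of_real (exp (- t))) * (Gamma w / of_real t powr w))"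
      unfolding K1 by (intro has_bochner_integral_mult_right has_bochner_integral_Gamma_scaled)
                      (use w True in auto)
    also have "(B t * of_real (exp (- t))) * (Gamma w / of_real t powr w) =
      Gamma w * (indicator {0<..} t *\<^sub>R (complex_of_real t powr (p - w - 1) / of_real (exp t)))"
      using True by (simp add: B_def exp_minus powr_diff powr_add field_simps)
    finally show ?thesis .
  qed (simp add: K_def B_def has_bochner_integral_zero)
  \<comment> \<open>The norm integrated over u is again a Gamma integrand in t, hence integrable, as
    the criterion for joint integrability demands.\<close>
  have normu: "(\<integral>u. norm (K t u) \<partial>lborel) =
     Gamma (Re w) * norm (indicator {0<..} t *\<^sub>R (complex_of_real t powr (p - w - 1) / of_real (exp t)))" for t
  proof (cases "t > 0")
    case True
    have "has_bochner_integral lborel (\<lambda>u. norm (K t u))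
        (norm (B t * of_real (exp (- t))) * (Gamma (Re w) / t powr Re w))"
      unfolding K1 norm_mult[of "B t * _"]
      by (intro has_bochner_integral_mult_right has_bochner_integral_norm_Gamma_scaled)
         (use w True in auto)
    also have "norm (B t * of_real (exp (- t))) * (Gamma (Re w) / t powr Re w) =
      Gamma (Re w) * norm (indicator {0<..} t *\<^sub>R (complex_of_real t powr (p - w - 1) / of_real (exp t)))"
      using True by (simp add: B_def exp_minus powr_diff powr_add norm_powr_real_powr norm_mult norm_divide field_simps)
    finally show ?thesis by (rule has_bochner_integral_integral_eq)
  qed (simp add: K_def B_def)
  have G: "has_bochner_integral lborel
     (\<lambda>t. indicator {0<..} t *\<^sub>R (complex_of_real t powr (p - w - 1) / of_real (exp t))) (Gamma (p - w))"
    by (rule has_bochner_integral_Gamma) (use w in simp)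
  have int: "integrable (lborel \<Otimes>\<^sub>M lborel) (case_prod K)"
  proof (rule lborel_pair.Fubini_integrable[OF meas])
    show "integrable lborel (\<lambda>t. \<integral>u. norm (case_prod K (t, u)) \<partial>lborel)"
      using integrable_norm[OF integrable.intros[OF G]]
      unfolding prod.case normu by (rule integrable_mult_right)
    show "AE t in lborel. integrable lborel (\<lambda>u. case_prod K (t, u))"
      using intu by (auto simp: has_bochner_integral_iff)
  qed
  have intt: "has_bochner_integral lborel (\<lambda>t. K t u)
      (Gamma p * (indicator {0<..} u *\<^sub>R (complex_of_real u powr (w - 1) / of_real (1 + u) powr p)))" for u
  proof (cases "u > 0")
    case True
    have "has_bochner_integral lborel (\<lambda>t. K t u) (A u * (Gamma p / of_real (1 + u) powr p))"
      unfolding K2 by (intro has_bochner_integral_mult_right has_bochner_integral_Gamma_scaled)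
                      (use w True in auto)
    then show ?thesis using True by (simp add: A_def mult_ac)
  qed (simp add: K_def A_def has_bochner_integral_zero)
  have Gp: "Gamma p \<noteq> 0"
    using w by (auto simp: Gamma_eq_zero_iff elim!: nonpos_Ints_cases)
  have I: "integrable lborel (\<lambda>u. \<integral>t. K t u \<partial>lborel)"
    using lborel_pair.integrable_snd[OF int] .
  have "(\<integral>u. (\<integral>t. K t u \<partial>lborel) \<partial>lborel) = (\<integral>t. (\<integral>u. K t u \<partial>lborel) \<partial>lborel)"
    by (rule lborel_pair.Fubini_integral[OF int])
  also have "\<dots> = Gamma w * Gamma (p - w)"
    by (simp only: has_bochner_integral_integral_eq[OF intu]
          has_bochner_integral_integral_eq[OF has_bochner_integral_mult_right[OF G]])
  finally have "has_bochner_integral lborel (\<lambda>u. \<integral>t. K t u \<partial>lborel) (Gamma w * Gamma (p - w))"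
    using I by (simp add: has_bochner_integral_iff)
  then have "has_bochner_integral lborel (\<lambda>u. 1 / Gamma p * (\<integral>t. K t u \<partial>lborel))
     (1 / Gamma p * (Gamma w * Gamma (p - w)))"
    by (rule has_bochner_integral_mult_right)
  then show ?thesis
    using Gp by (simp add: has_bochner_integral_integral_eq[OF intt] Beta_def)
qed

text \<open>\<^const>\<open>mellin_integrand\<close> carries the exponent \<open>-\<rho> - 1\<close>; here \<open>s\<close> is the usual Mellin variable.\<close>

definition has_mellin :: "(real \<Rightarrow> real) \<Rightarrow> complex \<Rightarrow> complex \<Rightarrow> bool" where
  "has_mellin f s I \<longleftrightarrow>
     has_bochner_integral lborel (\<lambda>u. indicator {0<..} u *\<^sub>R mellin_integrand f (- s) u) I"

lemma has_mellin_cong: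
  assumes "\<And>u. u > 0 \<Longrightarrow> f u = g u"
  shows "has_mellin f s I \<longleftrightarrow> has_mellin g s I"
proof -
  have "(\<lambda>u. indicator {0<..} u *\<^sub>R mellin_integrand f (- s) u) =
        (\<lambda>u. indicator {0<..} u *\<^sub>R mellin_integrand g (- s) u)"
    by (intro ext) (auto simp: mellin_integrand_def indicator_def assms)
  then show ?thesis unfolding has_mellin_def by simp
qed

lemma has_mellin_add:
  assumes "has_mellin f s I" "has_mellin g s J"
  shows "has_mellin (\<lambda>u. f u + g u) s (I + J)"
  using has_bochner_integral_add[OF assms[unfolded has_mellin_def]]
  unfolding has_mellin_def mellin_integrand_def by (simp add: algebra_simps)

lemma has_mellin_cmult:
  assumes "has_mellin f s I"
  shows "has_mellin (\<lambda>u. c * f u) s (of_real c * I)"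
  using has_bochner_integral_mult_right[OF assms[unfolded has_mellin_def], of "of_real c"]
  unfolding has_mellin_def mellin_integrand_def by (simp add: algebra_simps)

lemma has_mellin_uminus:
  assumes "has_mellin f s I"
  shows "has_mellin (\<lambda>u. - f u) s (- I)"
  using has_mellin_cmult[OF assms, of "-1"] by simp

lemma has_mellin_diff:
  assumes "has_mellin f s I" "has_mellin g s J"
  shows "has_mellin (\<lambda>u. f u - g u) s (I - J)"
  using has_mellin_add[OF assms(1) has_mellin_uminus[OF assms(2)]] by simp

lemma has_mellin_sum:
  assumes "\<And>i. i \<in> A \<Longrightarrow> has_mellin (f i) s (I i)"
  shows "has_mellin (\<lambda>u. \<Sum>i\<in>A. f i u) s (\<Sum>i\<in>A. I i)"
  using has_bochner_integral_sum[of A lborel, OF assms[unfolded has_mellin_def]]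
  unfolding has_mellin_def mellin_integrand_def
  by (simp add: sum_distrib_right scaleR_sum_right)

lemma has_mellin_power_shift:
  assumes "has_mellin f (s + of_nat k) I"
  shows "has_mellin (\<lambda>u. u ^ k * f u) s I"
proof -
  have "indicator {0<..} u *\<^sub>R mellin_integrand f (- (s + of_nat k)) u =
        indicator {0<..} u *\<^sub>R mellin_integrand (\<lambda>u. u ^ k * f u) (- s) u" for u
  proof (cases "u > 0")
    case True
    then have "complex_of_real u powr of_nat k = of_real u ^ k"
      by (intro powr_nat') auto
    then show ?thesis
      by (simp add: mellin_integrand_def powr_diff powr_add)
  qed auto
  then show ?thesis using assms by (simp only: has_mellin_def)
qed

lemma has_mellin_Beta:
  assumes "Re w > 0" "Re w < real p"
  shows "has_mellin (\<lambda>u. 1 / (1 + u) ^ p) w (Beta w (of_nat p - w))"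
proof -
  have "indicator {0<..} u *\<^sub>R (complex_of_real u powr (w - 1) / of_real (1 + u) powr (of_nat p)) =
      indicator {0<..} u *\<^sub>R mellin_integrand (\<lambda>u. 1 / (1 + u) ^ p) (- w) u" for u
  proof (cases "u > 0")
    case True
    then have "complex_of_real (1 + u) \<noteq> 0"
      unfolding of_real_eq_0_iff by simp
    then have "complex_of_real (1 + u) powr of_nat p = of_real (1 + u) ^ p"
      by (intro powr_nat') auto
    then show ?thesis
      by (simp add: mellin_integrand_def)
  qed auto
  then show ?thesis
    using has_bochner_integral_Beta[of w "of_nat p"] assms
    by (simp only: has_mellin_def complex_Re_of_nat)
qed

section \<open>Taylor remainders of (1 + u)^(-p) at 0\<close>

definition negbin_rem :: "nat \<Rightarrow> nat \<Rightarrow> real \<Rightarrow> real" where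
  "negbin_rem p N u = 1 / (1 + u) ^ p - (\<Sum>j<N. real ((p + j - 1) choose j) * (- u) ^ j)"

text \<open>Finite geometric sum. This closed form starts the inductions on
  \<open>p\<close>.\<close>

lemma negbin_rem_1:
  assumes "u > 0"
  shows "negbin_rem 1 N u = (-1) ^ N * (u ^ N * (1 / (1 + u) ^ 1))"
proof -
  have "(1 + u) * (\<Sum>j<N. (- u) ^ j) = 1 - (- u) ^ N"
    using one_diff_power_eq[of "- u" N] by simp
  with assms have "(\<Sum>j<N. (- u) ^ j) = (1 - (- u) ^ N) / (1 + u)"
    by (simp add: field_simps)
  then show ?thesis
    using assms by (simp add: negbin_rem_def diff_divide_distrib power_minus[of u])
qed

text \<open>The identity (1 + u)^(-p-1) = (1 + u)^(-p) - u (1 + u)^(-p-1) passes to the Taylor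
  coefficients by Pascal's rule. Each term on the right has a smaller \<open>p\<close> or a smaller
  \<open>N\<close>, which drives the nested inductions below.\<close>

lemma negbin_rem_Suc:
  assumes "u > 0" "p \<ge> 1"
  shows "negbin_rem (Suc p) (Suc N) u = negbin_rem p (Suc N) u - u * negbin_rem (Suc p) N u"
proof -
  have pascal: "real ((p + Suc j) choose Suc j) = real ((p + Suc j - 1) choose Suc j) + real ((p + j) choose j)"
    for j by simp
  have "(\<Sum>j<Suc N. real ((Suc p + j - 1) choose j) * (- u) ^ j) =
        1 + (\<Sum>j<N. real ((p + Suc j) choose Suc j) * (- u) ^ Suc j)"
    by (subst sum.lessThan_Suc_shift) simp
  also have "\<dots> = (1 + (\<Sum>j<N. real ((p + Suc j - 1) choose Suc j) * (- u) ^ Suc j))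
        - u * (\<Sum>j<N. real ((Suc p + j - 1) choose j) * (- u) ^ j)"
    unfolding pascal by (simp add: algebra_simps sum.distrib sum_distrib_left sum_negf sum_subtractf)
  also have "1 + (\<Sum>j<N. real ((p + Suc j - 1) choose Suc j) * (- u) ^ Suc j) =
        (\<Sum>j<Suc N. real ((p + j - 1) choose j) * (- u) ^ j)"
    by (simp add: sum.lessThan_Suc_shift del: sum.lessThan_Suc)
  finally have *: "(\<Sum>j<Suc N. real ((Suc p + j - 1) choose j) * (- u) ^ j) =
        (\<Sum>j<Suc N. real ((p + j - 1) choose j) * (- u) ^ j)
        - u * (\<Sum>j<N. real ((Suc p + j - 1) choose j) * (- u) ^ j)" .
  have "1 / (1 + u) ^ p = (1 + u) * (1 / (1 + u) ^ Suc p)"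
    using assms by simp
  then have "1 / (1 + u) ^ Suc p = 1 / (1 + u) ^ p - u * (1 / (1 + u) ^ Suc p)"
    by (simp add: add_divide_distrib del: power_Suc)
  then show ?thesis unfolding negbin_rem_def * by (simp only: right_diff_distrib)
qed

text \<open>Outer induction on \<open>N\<close>, inner on \<open>p\<close>: in the recurrence the
  factor u raises the order of the second term from \<open>N\<close> to
  \<open>Suc N\<close>.\<close>

lemma negbin_rem_bound:
  assumes "p \<ge> 1"
  shows "\<exists>C. \<forall>u>0. \<bar>negbin_rem p N u\<bar> \<le> C * u ^ N"
  using assms
proof (induction N arbitrary: p)
  case 0
  have "\<bar>negbin_rem p 0 u\<bar> \<le> 1 * u ^ 0" if "u > 0" for u
    using that by (simp add: negbin_rem_def)
  then show ?case by blast
next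
  case (Suc N p)
  from Suc.prems show ?case
  proof (induction p rule: dec_induct)
    case base
    have "\<bar>negbin_rem 1 (Suc N) u\<bar> \<le> 1 * u ^ Suc N" if "u > 0" for u
    proof -
      have "\<bar>negbin_rem 1 (Suc N) u\<bar> = u ^ Suc N * (1 / (1 + u))"
        using that unfolding negbin_rem_1[OF that] by (simp add: abs_mult power_abs)
      also have "\<dots> \<le> u ^ Suc N * 1"
        using that by (intro mult_left_mono) auto
      finally show ?thesis by simp
    qed
    then show ?case by blast
  next
    case (step p)
    from step.IH obtain C where C: "\<And>u. u > 0 \<Longrightarrow> \<bar>negbin_rem p (Suc N) u\<bar> \<le> C * u ^ Suc N" by blast
    from Suc.IH[of "Suc p"] obtain D where D: "\<And>u. u > 0 \<Longrightarrow> \<bar>negbin_rem (Suc p) N u\<bar> \<le> D * u ^ N" by auto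
    have "\<bar>negbin_rem (Suc p) (Suc N) u\<bar> \<le> (C + D) * u ^ Suc N" if u: "u > 0" for u
    proof -
      have "\<bar>negbin_rem (Suc p) (Suc N) u\<bar> \<le> \<bar>negbin_rem p (Suc N) u\<bar> + \<bar>u * negbin_rem (Suc p) N u\<bar>"
        unfolding negbin_rem_Suc[OF u step(1)] by (rule abs_triangle_ineq4)
      also have "\<bar>u * negbin_rem (Suc p) N u\<bar> = u * \<bar>negbin_rem (Suc p) N u\<bar>"
        using u by (simp add: abs_mult)
      also have "\<bar>negbin_rem p (Suc N) u\<bar> + u * \<bar>negbin_rem (Suc p) N u\<bar> \<le> C * u ^ Suc N + u * (D * u ^ N)"
        using u by (intro add_mono mult_left_mono C D) auto
      finally show ?thesis by (simp add: algebra_simps)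
    qed
    then show ?case by blast
  qed
qed

text \<open>Reflection turns both sides into multiples of 1 / sin, and each shift by 1 changes the
  sign of the sine.\<close>

lemma Beta_add_nat_reflect:
  fixes w :: complex
  shows "Beta (w + of_nat N) (1 - (w + of_nat N)) = (-1) ^ N * Beta w (1 - w)"
proof -
  have "sin (of_real pi * (w + of_nat N)) = (-1) ^ N * sin (of_real pi * w)"
  proof (induction N)
    case (Suc N)
    have "of_real pi * (w + of_nat (Suc N)) = of_real pi * (w + of_nat N) + of_real pi"
      by (simp add: algebra_simps)
    then show ?case using Suc by (simp add: sin_add)
  qed simp
  then show ?thesis
    by (cases "even N") (simp_all add: Beta_def Gamma_reflection_complex)
qed

text \<open>For p = 1 the closed form shifts w into 0 < Re < 1, where the Beta integral converges,
  and its sign cancels that of the reflected Beta value. The step in \<open>p\<close> matches the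
  recurrence with Beta w (p - w) = Beta w (p + 1 - w) + Beta (w + 1) (p - w).\<close>

lemma has_mellin_negbin_rem:
  assumes "- real N < Re w" "Re w < 1 - real N" "p \<ge> 1"
  shows "has_mellin (negbin_rem p N) w (Beta w (of_nat p - w))"
  using assms
proof (induction N arbitrary: p w)
  case 0
  then have "has_mellin (\<lambda>u. 1 / (1 + u) ^ p) w (Beta w (of_nat p - w))"
    by (intro has_mellin_Beta) auto
  then show ?case by (simp add: negbin_rem_def[abs_def])
next
  case (Suc N p w)
  from Suc.prems(3,1,2) show ?case
  proof (induction p rule: dec_induct)
    case base
    have "has_mellin (\<lambda>u. 1 / (1 + u) ^ 1) (w + of_nat (Suc N))
            (Beta (w + of_nat (Suc N)) (of_nat 1 - (w + of_nat (Suc N))))"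
      using base by (intro has_mellin_Beta) auto
    then have "has_mellin (\<lambda>u. (-1) ^ Suc N * (u ^ Suc N * (1 / (1 + u) ^ 1))) w
       (of_real ((-1) ^ Suc N) * Beta (w + of_nat (Suc N)) (of_nat 1 - (w + of_nat (Suc N))))"
      by (intro has_mellin_cmult has_mellin_power_shift)
    also have "of_real ((-1) ^ Suc N) * Beta (w + of_nat (Suc N)) (of_nat 1 - (w + of_nat (Suc N))) =
       Beta w (of_nat 1 - w)"
      unfolding of_nat_1 Beta_add_nat_reflect by (simp flip: mult.assoc power_add)
    finally show ?case
      by (subst has_mellin_cong[OF negbin_rem_1])
  next
    case (step p)
    \<comment> \<open>Adding 1 moves w from the strip for \<open>Suc N\<close> to the strip for
      \<open>N\<close>, so the outer hypothesis applies at \<open>Suc p\<close>.\<close>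
    have "has_mellin (negbin_rem (Suc p) N) (w + of_nat 1) (Beta (w + of_nat 1) (of_nat (Suc p) - (w + of_nat 1)))"
      using step by (intro Suc.IH) auto
    then have "has_mellin (\<lambda>u. negbin_rem p (Suc N) u - u ^ 1 * negbin_rem (Suc p) N u) w
       (Beta w (of_nat p - w) - Beta (w + of_nat 1) (of_nat (Suc p) - (w + of_nat 1)))"
      using step by (intro has_mellin_diff has_mellin_power_shift step.IH) auto
    also have "Beta w (of_nat p - w) - Beta (w + of_nat 1) (of_nat (Suc p) - (w + of_nat 1)) =
        Beta w (of_nat (Suc p) - w)"
    proof -
      \<comment> \<open>The open strip lies between consecutive integers.\<close>
      have 1: "w \<notin> \<int>\<^sub>\<le>\<^sub>0"
      proof
        assume "w \<in> \<int>\<^sub>\<le>\<^sub>0"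
        then obtain m :: nat where "w = - of_nat m" by (auto elim!: nonpos_Ints_cases')
        with step.prems have "real m < real (Suc N)" "real N < real m" by auto
        then show False by simp
      qed
      have 2: "of_nat p - w \<notin> \<int>\<^sub>\<le>\<^sub>0"
        using step by (auto elim!: nonpos_Ints_cases' simp: complex_eq_iff)
      show ?thesis
        using Beta_plus1_plus1[OF 1 2] by (simp add: algebra_simps)
    qed
    finally show ?case
      using step by (subst has_mellin_cong[OF negbin_rem_Suc]) auto
  qed
qed

text \<open>A single Mellin-integrable majorant \<open>G\<close> with summable weights makes the L1
  norms of the terms summable, which permits termwise integration.\<close>

lemma has_mellin_sums:
  assumes I: "\<And>i. has_mellin (f i) s (I i)"
    and F: "\<And>u. u > 0 \<Longrightarrow> (\<lambda>i. f i u) sums F u"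
    and bound: "\<And>i u. u > 0 \<Longrightarrow> \<bar>f i u\<bar> \<le> b i * \<bar>G u\<bar>"
    and b: "summable b" and G: "has_mellin G s J"
  shows "summable I" "has_mellin F s (\<Sum>i. I i)"
proof -
  define f' where "f' i u = indicator {0<..} u *\<^sub>R mellin_integrand (f i) (- s) u" for i u
  define G' where "G' u = indicator {0<..} u *\<^sub>R mellin_integrand G (- s) u" for u
  have int_f: "integrable lborel (f' i)" "integral\<^sup>L lborel (f' i) = I i" for i
    using I[of i] unfolding has_mellin_def has_bochner_integral_iff f'_def by auto
  have int_G: "integrable lborel G'"
    using G unfolding has_mellin_def has_bochner_integral_iff G'_def by auto
  have le: "norm (f' i u) \<le> b i * norm (G' u)" for i u
    using mult_right_mono[OF bound[of u i], of "norm (complex_of_real u powr (s - 1))"]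
    by (auto simp: f'_def G'_def indicator_def mellin_integrand_def norm_mult mult_ac)
  have 1: "AE u in lborel. summable (\<lambda>i. norm (f' i u))"
    using le by (intro AE_I2 summable_comparison_test'[OF summable_mult2[OF b]]) auto
  have 2: "summable (\<lambda>i. \<integral>u. norm (f' i u) \<partial>lborel)"
  proof (rule summable_comparison_test'[OF summable_mult2[OF b]])
    fix i :: nat
    have "(\<integral>u. norm (f' i u) \<partial>lborel) \<le> (\<integral>u. b i * norm (G' u) \<partial>lborel)"
      using int_f int_G le by (intro integral_mono) auto
    then show "norm (\<integral>u. norm (f' i u) \<partial>lborel) \<le> b i * (\<integral>u. norm (G' u) \<partial>lborel)"
      by simp
  qed
  have eq: "(\<Sum>i. f' i u) = indicator {0<..} u *\<^sub>R mellin_integrand F (- s) u" for u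
  proof (cases "u > 0")
    case True
    have "(\<lambda>i. complex_of_real (f i u) * complex_of_real u powr (s - 1)) sums
            (complex_of_real (F u) * complex_of_real u powr (s - 1))"
      using F[OF True] by (intro sums_mult2) (simp only: sums_of_real_iff)
    then show ?thesis
      using True by (simp add: f'_def mellin_integrand_def sums_iff)
  qed (simp add: f'_def)
  show "summable I"
    using summable_integral[OF int_f(1) 1 2] by (simp only: int_f(2))
  show "has_mellin F s (\<Sum>i. I i)"
    using integrable_suminf[OF int_f(1) 1 2] integral_suminf[OF int_f(1) 1 2]
    unfolding has_mellin_def has_bochner_integral_iff eq int_f(2) by simp
qed

text \<open>The tail has the factor t^N, and the remaining series is dominated by its absolute
  values at 1/2.\<close>

lemma powser_remainder_bound:
  fixes a :: "nat \<Rightarrow> real"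
  assumes "\<And>t. \<bar>t\<bar> < 1 \<Longrightarrow> (\<lambda>j. a j * t ^ j) sums F t"
  shows "\<exists>C. \<forall>t. 0 \<le> t \<and> t \<le> 1/2 \<longrightarrow> \<bar>F t - (\<Sum>j<N. a j * t ^ j)\<bar> \<le> C * t ^ N"
proof (intro exI allI impI)
  fix t :: real
  assume t: "0 \<le> t \<and> t \<le> 1/2"
  \<comment> \<open>Only the radius 1/2 enters \<open>C\<close>, so one constant serves every
    \<open>t\<close>.\<close>
  define C where "C = (\<Sum>j. \<bar>a (j + N)\<bar> * (1/2) ^ j)"
  \<comment> \<open>Convergence at 3/4, a point between 1/2 and 1, gives absolute convergence at
    1/2.\<close>
  have "summable (\<lambda>j. norm (a j * (1/2) ^ j))"
    using powser_insidea[of a "3/4" "1/2"] assms[of "3/4"] by (auto simp: sums_iff)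
  then have "summable (\<lambda>j. norm (a (j + N) * (1/2) ^ (j + N)))"
    by (subst summable_iff_shift)
  then have "summable (\<lambda>j. (1/2) ^ N * (\<bar>a (j + N)\<bar> * (1/2) ^ j))"
    by (simp add: abs_mult power_add mult_ac power_abs)
  then have summ: "summable (\<lambda>j. \<bar>a (j + N)\<bar> * (1/2) ^ j)"
    by (subst (asm) summable_cmult_iff) simp
  have "(\<lambda>j. a (j + N) * t ^ (j + N)) sums (F t - (\<Sum>j<N. a j * t ^ j))"
    using assms[of t] t by (subst sums_iff_shift) auto
  then have "F t - (\<Sum>j<N. a j * t ^ j) = (\<Sum>j. a (j + N) * t ^ (j + N))"
    by (simp add: sums_iff)
  also have "\<bar>\<dots>\<bar> \<le> (\<Sum>j. \<bar>a (j + N)\<bar> * (1/2) ^ j * t ^ N)"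
    unfolding real_norm_def[symmetric]
  proof (rule norm_suminf_le)
    show "norm (a (j + N) * t ^ (j + N)) \<le> norm (a (j + N)) * (1/2) ^ j * t ^ N" for j
      using t by (auto simp: abs_mult power_add mult.assoc intro!: mult_left_mono mult_right_mono power_mono)
    show "summable (\<lambda>j. norm (a (j + N)) * (1/2) ^ j * t ^ N)"
      using summ by (intro summable_mult2) simp
  qed
  also have "\<dots> = C * t ^ N"
    unfolding C_def by (rule suminf_mult2[symmetric, OF summ])
  finally show "\<bar>F t - (\<Sum>j<N. a j * t ^ j)\<bar> \<le> C * t ^ N" .
qed

text \<open>Letting u tend to 0 kills the constant coefficient, and cancelling a factor u allows
  induction. Taylor polynomials can thus be compared through their error bounds.\<close>

lemma poly_eq_0_if_small_at_0:
  fixes Q :: "real poly"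
  assumes "\<And>u. 0 < u \<Longrightarrow> u \<le> \<delta> \<Longrightarrow> \<bar>poly Q u\<bar> \<le> C * u ^ N" "\<delta> > 0" "degree Q < N"
  shows "Q = 0"
  using assms(1,3)
proof (induction N arbitrary: Q)
  case (Suc N Q)
  obtain a R where Q: "Q = pCons a R" by (cases Q)
  have ev: "\<forall>\<^sub>F u in at_right 0. 0 < u \<and> u \<le> \<delta>"
    using \<open>\<delta> > 0\<close> by (auto simp: eventually_at_right[of 0 "\<delta>"] intro!: exI[of _ \<delta>])
  have "((\<lambda>u. C * u ^ Suc N) \<longlongrightarrow> C * 0 ^ Suc N) (at_right 0)"
    by (intro tendsto_intros)
  moreover have "((\<lambda>u. \<bar>poly Q u\<bar>) \<longlongrightarrow> \<bar>poly Q 0\<bar>) (at_right 0)"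
    by (intro tendsto_intros)
  ultimately have "\<bar>poly Q 0\<bar> \<le> C * 0 ^ Suc N"
    by (rule tendsto_le[rotated]) (use ev Suc.prems(1) in \<open>auto elim!: eventually_mono\<close>)
  then have a: "a = 0" by (simp add: Q)
  have R: "\<bar>poly R u\<bar> \<le> C * u ^ N" if u: "0 < u" "u \<le> \<delta>" for u
    using Suc.prems(1)[OF u] u by (simp add: Q a abs_mult mult.left_commute)
  show ?case
  proof (cases "R = 0")
    case False
    then have "degree R < N" using Suc.prems(2) by (simp add: Q)
    from Suc.IH[OF R this] show ?thesis by (simp add: Q a)
  qed (simp add: Q a)
qed simp

section \<open>The generating function of the Gegenbauer polynomials\<close>

lemma pochhammer_fact_sums_real:
  fixes x l :: real
  assumes "\<bar>x\<bar> < 1"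
  shows "(\<lambda>k. pochhammer l k / fact k * x ^ k) sums ((1 - x) powr (- l))"
proof -
  have "(\<lambda>k. ((- l) gchoose k) * (- x) ^ k) sums (1 + (- x)) powr (- l)"
    by (rule gen_binomial_real) (use assms in simp)
  also have "(\<lambda>k. ((- l) gchoose k) * (- x) ^ k) = (\<lambda>k. pochhammer l k / fact k * x ^ k)"
  proof
    fix k show "((- l) gchoose k) * (- x) ^ k = pochhammer l k / fact k * x ^ k"
      by (cases "even k") (simp_all add: gbinomial_pochhammer)
  qed
  finally show ?thesis by simp
qed

section \<open>Expansion of the generating function in the functions \<open>g k\<close>\<close>

locale gegenbauer_mellin =
  fixes n :: nat and \<xi> :: real
  assumes n: "n \<ge> 3" and \<xi>: "- 1 < \<xi>" "\<xi> < 1"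
begin

definition l :: real where "l = (real n - 2) / 2"
definition z :: real where "z = (1 - \<xi>) / 2"
definition c :: "nat \<Rightarrow> real" where "c k = pochhammer l k / fact k * (4 * z) ^ k"
definition f :: "real \<Rightarrow> real" where "f u = (1 + 2 * u * \<xi> + u\<^sup>2) powr (- l)"
text \<open>As 2 * l = n - 2, the exponent 2 l + 2 k is a positive integer, so the results on (1 +
  u)^(-p) apply.\<close>

definition g :: "nat \<Rightarrow> real \<Rightarrow> real" where "g k u = u ^ k * (1 / (1 + u) ^ (n - 2 + 2 * k))"

lemma l_pos: "l > 0" and z_pos: "0 < z" and z_less_1: "z < 1"
  using n \<xi> by (auto simp: l_def z_def)

lemma g_eq:
  assumes "u > 0"
  shows "c k * g k u = 1 / (1 + u) ^ (n - 2) * (pochhammer l k / fact k * (4 * z * u / (1 + u)\<^sup>2) ^ k)"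
  by (simp add: c_def g_def power_add power_mult power_divide power_mult_distrib)
    (simp only: mult_ac)

lemma f_eq:
  assumes "u > 0"
  shows "f u = 1 / (1 + u) ^ (n - 2) * (1 - 4 * z * u / (1 + u)\<^sup>2) powr (- l)"
proof -
  have "1 + 2 * u * \<xi> + u\<^sup>2 = (1 + u)\<^sup>2 * (1 - 4 * z * u / (1 + u)\<^sup>2)"
    using assms by (simp add: right_diff_distrib) (simp add: z_def power2_eq_square field_simps)
  moreover have "((1 + u)\<^sup>2) powr (- l) = 1 / (1 + u) ^ (n - 2)"
  proof -
    have "((1 + u)\<^sup>2) powr (- l) = (1 + u) powr (- (2 * l))"
      using assms by (simp flip: powr_numeral add: powr_powr)
    also have "2 * l = real (n - 2)"
      using n by (simp add: l_def of_nat_diff)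
    finally show ?thesis
      using assms by (simp add: powr_minus powr_realpow inverse_eq_divide)
  qed
  ultimately show ?thesis
    unfolding f_def by (simp add: powr_mult)
qed

text \<open>This is (1 - u)^2 >= 0. It keeps the argument of the binomial series in [0, z] with z <
  1, uniformly in u.\<close>

lemma four_mult_over_square_bounds:
  fixes u :: real
  assumes "u > 0"
  shows "0 \<le> 4 * u / (1 + u)\<^sup>2" "4 * u / (1 + u)\<^sup>2 \<le> 1"
proof -
  have "4 * u \<le> (1 + u)\<^sup>2"
    using sum_squares_ge_zero[of "1 - u" 0] by (simp add: power2_eq_square algebra_simps)
  then show "4 * u / (1 + u)\<^sup>2 \<le> 1"
    using assms by (simp add: divide_le_eq_1)
qed (use assms in simp)

lemma f_sums:
  assumes "u > 0"
  shows "(\<lambda>k. c k * g k u) sums f u"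
proof -
  have "4 * z * u / (1 + u)\<^sup>2 = z * (4 * u / (1 + u)\<^sup>2)" by simp
  also have "\<dots> \<le> z * 1"
    using four_mult_over_square_bounds[OF assms] z_pos by (intro mult_left_mono) auto
  finally have "4 * z * u / (1 + u)\<^sup>2 \<le> z" by simp
  moreover have "0 \<le> 4 * z * u / (1 + u)\<^sup>2"
    using z_pos assms by simp
  ultimately have "\<bar>4 * z * u / (1 + u)\<^sup>2\<bar> < 1"
    using z_less_1 by linarith
  then show ?thesis
    unfolding f_eq[OF assms] g_eq[OF assms] by (intro sums_mult pochhammer_fact_sums_real)
qed

text \<open>The binomial series is cut off in x = 4 z u / (1 + u)^2, and x <= 4 u turns order
  \<open>N\<close> in x into order \<open>N\<close> in u. The limit 1/8 ensures x <= 1/2.\<close>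

lemma f_partial_bound:
  "\<exists>C. \<forall>u. 0 < u \<and> u \<le> 1/8 \<longrightarrow> \<bar>f u - (\<Sum>k<N. c k * g k u)\<bar> \<le> C * u ^ N"
proof -
  obtain C where C: "\<And>x. 0 \<le> x \<Longrightarrow> x \<le> 1/2 \<Longrightarrow>
      \<bar>(1 - x) powr (- l) - (\<Sum>k<N. pochhammer l k / fact k * x ^ k)\<bar> \<le> C * x ^ N"
    using powser_remainder_bound[OF pochhammer_fact_sums_real] by meson
  show ?thesis
  proof (intro exI allI impI)
    fix u :: real
    assume u: "0 < u \<and> u \<le> 1/8"
    let ?x = "4 * z * u / (1 + u)\<^sup>2"
    have "?x \<le> 4 * z * u / 1"
      using u z_pos by (intro divide_left_mono) (auto intro: one_le_power)
    also have "\<dots> \<le> 4 * 1 * u / 1"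
      using u z_less_1 by simp
    finally have x_le: "?x \<le> 4 * u" by simp
    have x0: "?x \<ge> 0" using u z_pos by simp
    have x12: "?x \<le> 1/2" using x_le u by linarith
    have "f u - (\<Sum>k<N. c k * g k u) = 1 / (1 + u) ^ (n - 2) *
        ((1 - ?x) powr (- l) - (\<Sum>k<N. pochhammer l k / fact k * ?x ^ k))"
      using u by (simp only: f_eq g_eq right_diff_distrib sum_distrib_left)
    then have "\<bar>f u - (\<Sum>k<N. c k * g k u)\<bar> = 1 / (1 + u) ^ (n - 2) *
        \<bar>(1 - ?x) powr (- l) - (\<Sum>k<N. pochhammer l k / fact k * ?x ^ k)\<bar>"
      using u by (simp add: abs_mult)
    also have "\<dots> \<le> 1 * (C * ?x ^ N)"
      using u C[OF x0 x12] by (intro mult_mono) auto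
    also have "\<dots> \<le> \<bar>C\<bar> * (4 * u) ^ N"
      unfolding mult_1 using x_le x0 by (intro mult_mono power_mono) auto
    finally show "\<bar>f u - (\<Sum>k<N. c k * g k u)\<bar> \<le> (\<bar>C\<bar> * 4 ^ N) * u ^ N"
      by (simp add: power_mult_distrib)
  qed
qed

text \<open>By the generating series this is the Taylor polynomial of \<open>f\<close> at 0 of
  degree below \<open>N\<close>; \<open>N = Suc q\<close> gives the sum in
  \<open>h_fun\<close>.\<close>

definition taylor :: "nat \<Rightarrow> real \<Rightarrow> real" where
  "taylor N u = (\<Sum>j<N. (- u) ^ j * gegenbauer l j \<xi>)"

lemma f_taylor_bound:
  "\<exists>C. \<forall>u. 0 < u \<and> u \<le> 1/2 \<longrightarrow> \<bar>f u - taylor N u\<bar> \<le> C * u ^ N"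
proof -
  have "(\<lambda>j. ((-1) ^ j * gegenbauer l j \<xi>) * t ^ j) sums f t" if "\<bar>t\<bar> < 1" for t
    using gegenbauer_sums[of \<xi> t l] \<xi> that
    by (simp add: f_def power_minus[of t] mult_ac)
  moreover have "taylor N u = (\<Sum>j<N. ((-1) ^ j * gegenbauer l j \<xi>) * u ^ j)" for u
    by (simp add: taylor_def power_minus[of u] mult_ac)
  ultimately show ?thesis
    using powser_remainder_bound[of "\<lambda>j. (-1) ^ j * gegenbauer l j \<xi>" f N] by (simp only:) (meson less_imp_le)
qed

text \<open>The Taylor polynomials of the \<open>c k * g k\<close> with k < N add up to that of
  \<open>f\<close>: both have degree below \<open>N\<close> and approximate \<open>f\<close> to
  order \<open>N\<close> at 0. The subtraction is thereby distributed over finitely many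
  summands.\<close>

lemma taylor_eq:
  assumes "u > 0"
  shows "f u - taylor N u = (\<Sum>k<N. c k * (u ^ k * negbin_rem (n - 2 + 2 * k) (N - k) u))
           + (f u - (\<Sum>k<N. c k * g k u))"
proof (cases "N = 0")
  case False
  define p where "p k = n - 2 + 2 * k" for k
  \<comment> \<open>The factor u^k of \<open>g k\<close> leaves room only for j < N - k in a
    polynomial of degree below \<open>N\<close>.\<close>
  define Q where "Q = (\<Sum>k<N. \<Sum>j<N - k. monom (c k * real ((p k + j - 1) choose j) * (-1) ^ j) (k + j))
      - (\<Sum>j<N. monom ((-1) ^ j * gegenbauer l j \<xi>) j)"
  have deg: "degree Q < N"
    unfolding Q_def using False
    by (intro degree_diff_less degree_sum_less) (auto intro: le_less_trans[OF degree_monom_le])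
  have polyQ: "poly Q u = (\<Sum>k<N. c k * g k u)
      - (\<Sum>k<N. c k * (u ^ k * negbin_rem (p k) (N - k) u)) - taylor N u" for u
  proof -
    have "(\<Sum>j<N - k. poly (monom (c k * real ((p k + j - 1) choose j) * (-1) ^ j) (k + j)) u) =
            c k * g k u - c k * (u ^ k * negbin_rem (p k) (N - k) u)" for k
    proof -
      have "c k * g k u - c k * (u ^ k * negbin_rem (p k) (N - k) u) =
          c k * (u ^ k * (\<Sum>j<N - k. real ((p k + j - 1) choose j) * (- u) ^ j))"
        unfolding g_def negbin_rem_def p_def by (simp only: right_diff_distrib)
      also have "\<dots> = (\<Sum>j<N - k. poly (monom (c k * real ((p k + j - 1) choose j) * (-1) ^ j) (k + j)) u)"
        unfolding sum_distrib_left
        by (intro sum.cong refl) (simp add: poly_monom power_add power_minus[of u] mult_ac)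
      finally show ?thesis ..
    qed
    moreover have "(\<Sum>j<N. poly (monom ((-1) ^ j * gegenbauer l j \<xi>) j) u) = taylor N u"
      unfolding taylor_def
      by (intro sum.cong refl) (simp add: poly_monom power_minus[of u] mult_ac)
    ultimately show ?thesis
      by (simp only: Q_def poly_diff poly_sum sum_subtractf)
  qed
  have "\<exists>C. \<forall>k\<in>{..<N}. \<forall>u>0. \<bar>negbin_rem (p k) (N - k) u\<bar> \<le> C k * u ^ (N - k)"
    by (rule bchoice) (use n in \<open>auto intro!: negbin_rem_bound simp: p_def\<close>)
  then obtain C where C: "\<And>k u. k < N \<Longrightarrow> u > 0 \<Longrightarrow> \<bar>negbin_rem (p k) (N - k) u\<bar> \<le> C k * u ^ (N - k)"
    by auto
  obtain C1 where C1: "\<And>u. 0 < u \<Longrightarrow> u \<le> 1/8 \<Longrightarrow> \<bar>f u - (\<Sum>k<N. c k * g k u)\<bar> \<le> C1 * u ^ N"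
    using f_partial_bound by meson
  obtain C2 where C2: "\<And>u. 0 < u \<Longrightarrow> u \<le> 1/2 \<Longrightarrow> \<bar>f u - taylor N u\<bar> \<le> C2 * u ^ N"
    using f_taylor_bound by meson
  \<comment> \<open>\<open>Q\<close> has degree below \<open>N\<close> and is \<open>O(u ^ N)\<close>, a combination of three remainders of that size.\<close>
  have "Q = 0"
  proof (rule poly_eq_0_if_small_at_0[OF _ _ deg])
    fix u :: real assume u: "0 < u" "u \<le> 1/8"
    have "\<bar>\<Sum>k<N. c k * (u ^ k * negbin_rem (p k) (N - k) u)\<bar> \<le> (\<Sum>k<N. \<bar>c k\<bar> * C k * u ^ N)"
    proof (rule order.trans[OF sum_abs sum_mono])
      fix k assume "k \<in> {..<N}"
      then have k: "k < N" by simp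
      have "\<bar>c k * (u ^ k * negbin_rem (p k) (N - k) u)\<bar> = \<bar>c k\<bar> * (u ^ k * \<bar>negbin_rem (p k) (N - k) u\<bar>)"
        using u by (simp add: abs_mult)
      also have "\<dots> \<le> \<bar>c k\<bar> * (u ^ k * (C k * u ^ (N - k)))"
        using u C[OF k u(1)] by (intro mult_left_mono) auto
      also have "u ^ k * (C k * u ^ (N - k)) = C k * u ^ N"
        using k by (simp add: mult.left_commute flip: power_add)
      finally show "\<bar>c k * (u ^ k * negbin_rem (p k) (N - k) u)\<bar> \<le> \<bar>c k\<bar> * C k * u ^ N"
        by (simp add: mult.assoc)
    qed
    moreover have "poly Q u = (f u - taylor N u) - (f u - (\<Sum>k<N. c k * g k u))
        - (\<Sum>k<N. c k * (u ^ k * negbin_rem (p k) (N - k) u))"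
      by (simp add: polyQ)
    ultimately have "\<bar>poly Q u\<bar> \<le> C2 * u ^ N + C1 * u ^ N + (\<Sum>k<N. \<bar>c k\<bar> * C k * u ^ N)"
      using C1[of u] C2[of u] u by linarith
    then show "\<bar>poly Q u\<bar> \<le> (C2 + C1 + (\<Sum>k<N. \<bar>c k\<bar> * C k)) * u ^ N"
      by (simp add: distrib_right sum_distrib_right)
  qed simp
  then show ?thesis
    using polyQ[of u] by (simp add: p_def)
qed (simp add: taylor_def)

text \<open>For k < N, s + k lies in the strip belonging to a remainder after N - k terms. For k >=
  N its real part is positive and the plain Beta integral converges; this tail is integrated
  termwise under multiples of \<open>g N\<close>.\<close>

lemma has_mellin_f_minus_taylor:
  assumes "- real N < Re s" "Re s < 1 - real N"
  defines "I \<equiv> (\<lambda>k. of_real (c k) * Beta (s + of_nat k) (of_nat (n - 2 + 2 * k) - (s + of_nat k)))"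
  shows "summable I" "has_mellin (\<lambda>u. f u - taylor N u) s (\<Sum>k. I k)"
proof -
  have fin: "has_mellin (\<lambda>u. \<Sum>k<N. c k * (u ^ k * negbin_rem (n - 2 + 2 * k) (N - k) u)) s (\<Sum>k<N. I k)"
    unfolding I_def
    by (intro has_mellin_sum has_mellin_cmult has_mellin_power_shift has_mellin_negbin_rem)
       (use assms n in \<open>auto simp: of_nat_diff\<close>)
  have g: "has_mellin (g k) s (Beta (s + of_nat k) (of_nat (n - 2 + 2 * k) - (s + of_nat k)))" if "k \<ge> N" for k
    unfolding g_def[abs_def]
    by (intro has_mellin_power_shift has_mellin_Beta) (use assms that n in auto)
  have g_nonneg: "g k u \<ge> 0" if "u > 0" for k u
    using that by (simp add: g_def)
  \<comment> \<open>Each further \<open>g\<close> gains a factor u / (1 + u)^2 <= 1/4, which absorbs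
    4^k from \<open>c (k + N)\<close>. What is left is 4^N times a term of the binomial series at z
    < 1.\<close>
  have bound: "\<bar>c (k + N) * g (k + N) u\<bar> \<le> (pochhammer l (k + N) / fact (k + N) * z ^ (k + N) * 4 ^ N) * \<bar>g N u\<bar>"
    if u: "u > 0" for k u
  proof -
    have l0: "pochhammer l j \<ge> 0" for j
      using l_pos by (intro pochhammer_nonneg) auto
    have "g (k + N) u * 4 ^ k = (4 * u / (1 + u)\<^sup>2) ^ k * g N u"
      using u by (simp add: g_def power_add power_divide power_mult_distrib power_mult)
        (simp only: mult_ac)
    also have "\<dots> \<le> 1 * g N u"
      using four_mult_over_square_bounds[OF u] g_nonneg[OF u] by (intro mult_right_mono power_le_one) auto
    finally have "g (k + N) u * 4 ^ k \<le> g N u" by simp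
    then have "(pochhammer l (k + N) / fact (k + N) * z ^ (k + N) * 4 ^ N) * (g (k + N) u * 4 ^ k) \<le>
               (pochhammer l (k + N) / fact (k + N) * z ^ (k + N) * 4 ^ N) * g N u"
      using l0 z_pos by (intro mult_left_mono) auto
    moreover have "\<bar>c (k + N) * g (k + N) u\<bar> =
      (pochhammer l (k + N) / fact (k + N) * z ^ (k + N) * 4 ^ N) * (g (k + N) u * 4 ^ k)"
      using l0 z_pos g_nonneg[OF u] by (simp add: c_def abs_mult power_mult_distrib power_add)
    ultimately show ?thesis using g_nonneg[OF u] by simp
  qed
  have summ_b: "summable (\<lambda>k. pochhammer l (k + N) / fact (k + N) * z ^ (k + N) * 4 ^ N)"
    using pochhammer_fact_sums_real[of z l] z_pos z_less_1
    by (intro summable_mult2) (subst summable_iff_shift, auto simp: sums_iff)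
  have I': "has_mellin (\<lambda>u. c (k + N) * g (k + N) u) s (I (k + N))" for k
    unfolding I_def by (intro has_mellin_cmult g) simp
  have sums: "(\<lambda>k. c (k + N) * g (k + N) u) sums (f u - (\<Sum>k<N. c k * g k u))" if "u > 0" for u
    using f_sums[OF that] by (subst sums_iff_shift) simp
  note tail = has_mellin_sums[OF I' sums bound summ_b g[OF order.refl]]
  show summ: "summable I"
    using tail(1) by (simp only: summable_iff_shift)
  have "has_mellin (\<lambda>u. (\<Sum>k<N. c k * (u ^ k * negbin_rem (n - 2 + 2 * k) (N - k) u))
           + (f u - (\<Sum>k<N. c k * g k u))) s ((\<Sum>k<N. I k) + (\<Sum>k. I (k + N)))"
    by (intro has_mellin_add fin tail(2))
  also have "(\<Sum>k<N. I k) + (\<Sum>k. I (k + N)) = (\<Sum>k. I k)"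
    using suminf_split_initial_segment[OF summ, of N] by simp
  finally show "has_mellin (\<lambda>u. f u - taylor N u) s (\<Sum>k. I k)"
    by (subst has_mellin_cong[OF taylor_eq])
qed

text \<open>With m = n - 2, the Gamma values are reduced to k = 0 by Pochhammer symbols. Duplication
  of the symbol of m at 2 k yields 4^k and the symbols of m / 2 and (m + 1) / 2; the first two
  cancel against \<open>c k\<close>, the last supplies the lower parameter (n - 1) / 2.\<close>

lemma Beta_term_eq:
  fixes s :: complex
  assumes "s \<notin> \<int>\<^sub>\<le>\<^sub>0" "of_nat (n - 2) - s \<notin> \<int>\<^sub>\<le>\<^sub>0"
  shows "of_real (c k) * Beta (s + of_nat k) (of_nat (n - 2 + 2 * k) - (s + of_nat k)) =
     Beta s (of_nat (n - 2) - s) * (pochhammer s k * pochhammer (of_nat (n - 2) - s) k /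
        (pochhammer ((of_nat n - 1) / 2) k * fact k) * of_real z ^ k)"
proof -
  define m where "m = n - 2"
  have m: "m \<ge> 1" "complex_of_nat n = of_nat m + 2"
    using n by (auto simp: m_def of_nat_diff)
  have mnp: "(of_nat m :: complex) \<notin> \<int>\<^sub>\<le>\<^sub>0"
    using m by (auto elim!: nonpos_Ints_cases' simp flip: of_nat_add simp: eq_neg_iff_add_eq_0)
  have G1: "Gamma (s + of_nat k) = Gamma s * pochhammer s k"
    using assms(1) by (subst pochhammer_Gamma) (auto simp: Gamma_eq_zero_iff)
  have G2: "Gamma (of_nat (m + 2 * k) - (s + of_nat k)) =
      Gamma (of_nat m - s) * pochhammer (of_nat m - s) k"
    using assms(2) unfolding m_def[symmetric]
    by (subst pochhammer_Gamma) (auto simp: Gamma_eq_zero_iff algebra_simps)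
  have G3: "Gamma (of_nat (m + 2 * k)) = Gamma (of_nat m :: complex) * pochhammer (of_nat m) (2 * k)"
    using mnp by (subst pochhammer_Gamma) (auto simp: Gamma_eq_zero_iff)
  have P: "pochhammer (of_nat m :: complex) (2 * k) =
      4 ^ k * pochhammer (of_nat m / 2) k * pochhammer ((of_nat m + 1) / 2) k"
    using pochhammer_double[of "of_nat m / 2 :: complex" k]
    by (simp add: power_mult add_divide_distrib)
  have l: "complex_of_real (pochhammer l k) = pochhammer (of_nat m / 2) k"
    using n by (simp add: l_def m_def of_nat_diff flip: pochhammer_of_real)
  have nz: "pochhammer (complex_of_nat m / 2) k \<noteq> 0"
  proof -
    have "pochhammer l k > 0" using l_pos by (rule pochhammer_pos)
    then show ?thesis unfolding l[symmetric] by simp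
  qed
  have sum_arg: "(s + of_nat k) + (of_nat (m + 2 * k) - (s + of_nat k)) = of_nat (m + 2 * k)"
    by simp
  have "of_real (c k) * Beta (s + of_nat k) (of_nat (m + 2 * k) - (s + of_nat k)) =
     pochhammer (of_nat m / 2) k / fact k * (4 * of_real z) ^ k *
     (Gamma s * pochhammer s k * (Gamma (of_nat m - s) * pochhammer (of_nat m - s) k) /
      (Gamma (of_nat m) * (4 ^ k * pochhammer (of_nat m / 2) k * pochhammer ((of_nat m + 1) / 2) k)))"
    by (simp only: Beta_def sum_arg G1 G2 G3 P l c_def of_real_mult of_real_divide of_real_fact
          of_real_power of_real_numeral)
  also have "\<dots> = Beta s (of_nat m - s) * (pochhammer s k * pochhammer (of_nat m - s) k /
        (pochhammer ((of_nat m + 1) / 2) k * fact k) * of_real z ^ k)"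
    using nz by (simp add: Beta_def power_mult_distrib mult_ac)
  also have "(of_nat m + 1) / 2 = (of_nat n - 1 :: complex) / 2"
    by (simp add: m)
  finally show ?thesis unfolding m_def .
qed

lemma has_mellin_f_minus_taylor_hyp2F1:
  assumes "- real N < Re s" "Re s < 1 - real N" "s \<notin> \<int>\<^sub>\<le>\<^sub>0"
  shows "has_mellin (\<lambda>u. f u - taylor N u) s
     (Beta s (of_nat (n - 2) - s) * hyp2F1 s (of_nat (n - 2) - s) ((of_nat n - 1) / 2) (of_real z))"
proof -
  have 2: "of_nat (n - 2) - s \<notin> \<int>\<^sub>\<le>\<^sub>0"
    using assms n by (auto elim!: nonpos_Ints_cases' simp: complex_eq_iff)
  have c: "(of_nat n - 1) / 2 \<notin> (\<int>\<^sub>\<le>\<^sub>0 :: complex set)"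
    using n by (auto elim!: nonpos_Ints_cases' simp: complex_eq_iff)
  have "(\<lambda>k. of_real (c k) * Beta (s + of_nat k) (of_nat (n - 2 + 2 * k) - (s + of_nat k))) sums
     (Beta s (of_nat (n - 2) - s) * hyp2F1 s (of_nat (n - 2) - s) ((of_nat n - 1) / 2) (of_real z))"
    unfolding Beta_term_eq[OF assms(3) 2]
    by (intro sums_mult hyp2F1_sums c) (use z_pos z_less_1 in simp)
  then show ?thesis
    using has_mellin_f_minus_taylor(2)[OF assms(1,2)] by (simp only: sums_iff)
qed

end

section \<open>Evaluation in terms of the Legendre function\<close>

text \<open>The product is Gamma (n - 2 + \<rho>) / Gamma (\<rho> + 1), and Gamma (- \<rho>) Gamma
  (\<rho> + 1) = - pi / sin (pi \<rho>) by reflection, which also cancels the leading minus.\<close>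

lemma Beta_minus_reflect:
  fixes \<rho> :: complex
  assumes "n \<ge> 3" "Re \<rho> > 0"
  shows "- Beta (- \<rho>) (of_nat (n - 2) + \<rho>) =
     of_real pi * (\<Prod>k=1..n-3. \<rho> + of_nat k) / (fact (n - 3) * sin (of_real pi * \<rho>))"
proof -
  have np: "\<rho> + 1 \<notin> \<int>\<^sub>\<le>\<^sub>0"
    using assms(2) by (auto elim!: nonpos_Ints_cases' simp: complex_eq_iff)
  have "(\<Prod>k=1..n-3. \<rho> + of_nat k) = pochhammer (\<rho> + 1) (n - 3)"
    unfolding pochhammer_prod
    by (rule prod.reindex_bij_witness[of _ Suc "\<lambda>k. k - 1"]) (auto simp: of_nat_diff)
  also have "\<dots> = Gamma (of_nat (n - 2) + \<rho>) / Gamma (\<rho> + 1)"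
    using assms(1) by (subst pochhammer_Gamma[OF np]) (simp add: of_nat_diff algebra_simps)
  finally have prod: "Gamma (of_nat (n - 2) + \<rho>) = Gamma (\<rho> + 1) * (\<Prod>k=1..n-3. \<rho> + of_nat k)"
    using np by (simp add: Gamma_eq_zero_iff)
  have fact: "Gamma (of_nat (n - 2)) = (fact (n - 3) :: complex)"
  proof -
    have "n - 2 = Suc (n - 3)" using assms(1) by simp
    then show ?thesis using Gamma_fact[of "n - 3", where ?'a = complex] by (simp add: add.commute)
  qed
  have refl: "Gamma (- \<rho>) * Gamma (\<rho> + 1) = - (of_real pi / sin (of_real pi * \<rho>))"
    using Gamma_reflection_complex[of "- \<rho>"] by (simp add: add.commute)
  have "Beta (- \<rho>) (of_nat (n - 2) + \<rho>) =
      (Gamma (- \<rho>) * Gamma (\<rho> + 1)) * (\<Prod>k=1..n-3. \<rho> + of_nat k) / fact (n - 3)"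
    by (simp add: Beta_def prod fact)
  then show ?thesis
    unfolding refl by (simp add: field_simps)
qed

text \<open>Legendre's duplication formula at x = (n - 2) / 2, where Gamma (2 x) = (n - 3)!. It
  reconciles the constants of the two closed forms.\<close>

lemma Gamma_half_duplication:
  assumes "n \<ge> 3"
  shows "sqrt pi * 2 powr ((3 - real n) / 2) / Gamma ((real n - 2) / 2) =
     2 powr ((real n - 3) / 2) * Gamma ((real n - 1) / 2) / fact (n - 3)"
proof -
  define x where "x = (real n - 2) / 2"
  have x: "x > 0" using assms by (simp add: x_def)
  have np: "complex_of_real x \<notin> \<int>\<^sub>\<le>\<^sub>0" "complex_of_real x + 1 / 2 \<notin> \<int>\<^sub>\<le>\<^sub>0"
    using x by (auto elim!: nonpos_Ints_cases' simp: complex_eq_iff)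
  have "Gamma (complex_of_real x) * Gamma (complex_of_real (x + 1 / 2)) =
      exp (complex_of_real ((1 - 2 * x) * ln 2)) * of_real (sqrt pi) * Gamma (complex_of_real (2 * x))"
    using Gamma_legendre_duplication[OF np] by simp
  then have "complex_of_real (Gamma x * Gamma (x + 1 / 2)) =
      complex_of_real (exp ((1 - 2 * x) * ln 2) * sqrt pi * Gamma (2 * x))"
    unfolding Gamma_complex_of_real exp_of_real by (simp only: of_real_mult)
  then have "Gamma x * Gamma (x + 1 / 2) = exp ((1 - 2 * x) * ln 2) * sqrt pi * Gamma (2 * x)"
    by (simp only: of_real_eq_iff)
  also have "exp ((1 - 2 * x) * ln 2) = 2 powr (1 - 2 * x)"
    by (simp add: powr_def)
  also have "2 * x = 1 + real (n - 3)"
    using assms by (simp add: x_def of_nat_diff)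
  also have "Gamma (1 + real (n - 3)) = fact (n - 3)"
    by (rule Gamma_fact)
  also have "x + 1 / 2 = (real n - 1) / 2"
    by (simp add: x_def field_simps)
  finally have dup: "Gamma x * Gamma ((real n - 1) / 2) = 2 powr (3 - real n) * sqrt pi * fact (n - 3)"
    using assms by (simp add: of_nat_diff)
  have "2 powr ((3 - real n) / 2) = 2 powr ((real n - 3) / 2) * 2 powr (3 - real n)"
    by (simp flip: powr_add add: field_simps)
  then show ?thesis
    using dup Gamma_real_pos[OF x] unfolding x_def[symmetric] by (simp add: field_simps)
qed

text \<open>With c = (n - 1) / 2 = 1 - \<mu>, Euler's transformation gives the upper parameters c +
  \<rho> and 1 - c - \<rho>, which are -\<nu> and \<nu> + 1 for \<nu> = - \<rho> - c. Its power of 1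
  - z accounts for the elementary factors.\<close>

lemma hyp2F1_conv_legendre_P_cut:
  assumes "n \<ge> 3" "- 1 < \<xi>" "\<xi> < 1"
  shows "hyp2F1 (- \<rho>) (of_nat (n - 2) + \<rho>) ((of_nat n - 1) / 2) (of_real ((1 - \<xi>) / 2)) =
     of_real (2 powr ((real n - 3) / 2) * Gamma ((real n - 1) / 2) * (1 - \<xi>\<^sup>2) powr ((3 - real n) / 4))
       * legendre_P_cut ((3 - of_nat n) / 2) (- \<rho> - (of_nat n - 1) / 2) \<xi>"
proof -
  define c where "c = (real n - 1) / 2"
  define z where "z = (1 - \<xi>) / 2"
  define H where "H = hyp2F1 (of_real c + \<rho>) (1 - of_real c - \<rho>) (of_real c) (of_real z)"
  have c: "(of_nat n - 1) / 2 = complex_of_real c"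
    by (simp add: c_def)
  have c_pos: "c > 0" using assms by (simp add: c_def)
  have np: "complex_of_real c \<notin> \<int>\<^sub>\<le>\<^sub>0"
    using c_pos by (auto elim!: nonpos_Ints_cases' simp: complex_eq_iff)
  have n2: "complex_of_nat (n - 2) = 2 * of_real c - 1"
    using assms by (simp add: c_def of_nat_diff field_simps)
  have n3: "(3 - complex_of_nat n) / 2 = of_real (1 - c)"
    by (simp add: c_def field_simps)
  have z: "0 < z" "z < 1" using assms by (auto simp: z_def)
  have legendre: "legendre_P_cut ((3 - of_nat n) / 2) (- \<rho> - (of_nat n - 1) / 2) \<xi> =
      of_real (1 / Gamma c * ((1 + \<xi>) / (1 - \<xi>)) powr ((1 - c) / 2)) * H"
  proof -
    have "complex_of_real ((1 + \<xi>) / (1 - \<xi>)) powr (of_real (1 - c) / 2) =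
        of_real (((1 + \<xi>) / (1 - \<xi>)) powr ((1 - c) / 2))"
      using assms by (subst powr_of_real[symmetric]) auto
    then show ?thesis
      unfolding legendre_P_cut_def c n3 H_def z_def
      by (simp add: Gamma_complex_of_real algebra_simps)
  qed
  have "hyp2F1 (- \<rho>) (of_nat (n - 2) + \<rho>) (of_real c) (of_real z) =
      (1 - of_real z) powr (of_real c - (- \<rho>) - (of_nat (n - 2) + \<rho>)) *
      hyp2F1 (of_real c - (- \<rho>)) (of_real c - (of_nat (n - 2) + \<rho>)) (of_real c) (of_real z)"
    by (rule hyp2F1_Euler[OF np]) (use z in simp)
  also have "of_real c - (- \<rho>) - (of_nat (n - 2) + \<rho>) = of_real (1 - c)"
    by (simp add: n2)
  also have "of_real c - (- \<rho>) = of_real c + \<rho>" by simp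
  also have "of_real c - (of_nat (n - 2) + \<rho>) = 1 - of_real c - \<rho>"
    by (simp add: n2)
  also have "(1 - complex_of_real z) powr of_real (1 - c) = of_real ((1 - z) powr (1 - c))"
    using z by (subst powr_of_real[symmetric]) auto
  \<comment> \<open>Here 1 - z = (1 + \<xi>) / 2, and (1 - \<xi>^2) (1 + \<xi>) / (1 - \<xi>) = (1 +
    \<xi>)^2. The last factor is the one inside the Legendre function.\<close>
  also have "(1 - z) powr (1 - c) = 2 powr (c - 1) * (1 - \<xi>\<^sup>2) powr ((1 - c) / 2) *
      ((1 + \<xi>) / (1 - \<xi>)) powr ((1 - c) / 2)"
  proof -
    have "(1 - \<xi>\<^sup>2) powr ((1 - c) / 2) * ((1 + \<xi>) / (1 - \<xi>)) powr ((1 - c) / 2) =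
        ((1 - \<xi>\<^sup>2) * ((1 + \<xi>) / (1 - \<xi>))) powr ((1 - c) / 2)"
      by (rule powr_mult[symmetric])
    also have "(1 - \<xi>\<^sup>2) * ((1 + \<xi>) / (1 - \<xi>)) = (1 + \<xi>) powr 2"
      using assms by (simp add: field_simps power2_eq_square)
    also have "\<dots> powr ((1 - c) / 2) = (1 + \<xi>) powr (1 - c)"
      by (simp add: powr_powr diff_divide_distrib)
    also have "(1 + \<xi>) powr (1 - c) = 2 powr (1 - c) * (1 - z) powr (1 - c)"
    proof -
      have "1 + \<xi> = 2 * (1 - z)" by (simp add: z_def field_simps)
      then show ?thesis by (simp only: powr_mult)
    qed
    finally have "(1 - \<xi>\<^sup>2) powr ((1 - c) / 2) * ((1 + \<xi>) / (1 - \<xi>)) powr ((1 - c) / 2) =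
        2 powr (1 - c) * (1 - z) powr (1 - c)" .
    moreover have "2 powr (c - 1) * 2 powr (1 - c) = (1 :: real)"
      by (simp flip: powr_add)
    ultimately show ?thesis by (simp only: mult.assoc) (simp flip: mult.assoc)
  qed
  finally have H: "hyp2F1 (- \<rho>) (of_nat (n - 2) + \<rho>) (of_real c) (of_real z) =
      of_real (2 powr (c - 1) * (1 - \<xi>\<^sup>2) powr ((1 - c) / 2) * ((1 + \<xi>) / (1 - \<xi>)) powr ((1 - c) / 2)) * H"
    unfolding H_def .
  have params: "(real n - 3) / 2 = c - 1" "(3 - real n) / 4 = (1 - c) / 2" "(real n - 1) / 2 = c"
    by (simp_all add: c_def field_simps)
  show ?thesis
    using H Gamma_real_pos[OF c_pos] unfolding legendre
    unfolding c params z_def[symmetric] by simp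
qed

text \<open>Integrability is part of the claim because the integral of a non-integrable function is
  0 by convention, so a value of \<open>mellin_M\<close> alone would not express
  convergence.\<close>

theorem mainTheorem2:
  fixes n q :: nat and \<xi> :: real and \<rho> :: complex
  assumes "n \<ge> 3"
    and "- 1 < \<xi>" and "\<xi> < 1"
    and "real q < Re \<rho>" and "Re \<rho> < real q + 1"
  shows "set_integrable lborel {0<..} (mellin_integrand (h_fun n q \<xi>) \<rho>)
    \<and> mellin_M (h_fun n q \<xi>) \<rho> =
        of_real (pi * sqrt pi * 2 powr ((3 - real n) / 2)) * (\<Prod>k=1..n-3. \<rho> + of_nat k)
          * of_real ((1 - \<xi>\<^sup>2) powr ((3 - real n) / 4))
          / (sin (of_real pi * \<rho>) * of_real (Gamma ((real n - 2) / 2)))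
          * legendre_P_cut ((3 - of_nat n) / 2) (- \<rho> - (of_nat n - 1) / 2) \<xi>
    \<and> mellin_M (h_fun n q \<xi>) \<rho> =
        of_real (pi * 2 powr ((real n - 3) / 2)) * (\<Prod>k=1..n-3. \<rho> + of_nat k)
          * of_real (Gamma ((real n - 1) / 2) * (1 - \<xi>\<^sup>2) powr ((3 - real n) / 4))
          / (fact (n - 3) * sin (of_real pi * \<rho>))
          * legendre_P_cut ((3 - of_nat n) / 2) (- \<rho> - (of_nat n - 1) / 2) \<xi>"
    (is "?int \<and> ?M = ?A \<and> ?M = ?B")
proof -
  interpret gegenbauer_mellin n \<xi>
    by unfold_locales fact+
  let ?P = "legendre_P_cut ((3 - of_nat n) / 2) (- \<rho> - (of_nat n - 1) / 2) \<xi>"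
  have np: "- \<rho> \<notin> \<int>\<^sub>\<le>\<^sub>0"
  proof
    assume "- \<rho> \<in> \<int>\<^sub>\<le>\<^sub>0"
    then obtain m :: nat where "\<rho> = of_nat m" by (auto elim!: nonpos_Ints_cases')
    with assms have "real q < real m" "real m < real (Suc q)" by auto
    then show False by simp
  qed
  \<comment> \<open>The sum over j = 0..q has q + 1 terms. With N = Suc q the strip for s = - \<rho>
    is exactly q < Re \<rho> < q + 1.\<close>
  have h: "h_fun n q \<xi> u = - (f u - taylor (Suc q) u)" for u
    by (simp add: h_fun_def f_def taylor_def l_def lessThan_Suc_atMost atLeast0AtMost)
  have "has_mellin (\<lambda>u. - (f u - taylor (Suc q) u)) (- \<rho>)
     (- (Beta (- \<rho>) (of_nat (n - 2) - (- \<rho>)) *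
        hyp2F1 (- \<rho>) (of_nat (n - 2) - (- \<rho>)) ((of_nat n - 1) / 2) (of_real z)))"
    by (intro has_mellin_uminus has_mellin_f_minus_taylor_hyp2F1 np) (use assms in auto)
  then have mellin: "has_mellin (h_fun n q \<xi>) (- \<rho>)
     (- Beta (- \<rho>) (of_nat (n - 2) + \<rho>) *
        hyp2F1 (- \<rho>) (of_nat (n - 2) + \<rho>) ((of_nat n - 1) / 2) (of_real ((1 - \<xi>) / 2)))"
    by (simp add: h[abs_def] z_def)
  then have int: ?int
    by (simp add: has_mellin_def has_bochner_integral_iff set_integrable_def)
  have M: "?M = - Beta (- \<rho>) (of_nat (n - 2) + \<rho>) *
        hyp2F1 (- \<rho>) (of_nat (n - 2) + \<rho>) ((of_nat n - 1) / 2) (of_real ((1 - \<xi>) / 2))"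
    using mellin by (simp add: has_mellin_def has_bochner_integral_iff mellin_M_def set_lebesgue_integral_def)
  have Re_pos: "Re \<rho> > 0"
    using assms(4) by (rule le_less_trans[rotated]) simp
  have B: "?M = ?B"
    unfolding M Beta_minus_reflect[OF assms(1) Re_pos] hyp2F1_conv_legendre_P_cut[OF assms(1-3)]
    by simp
  \<comment> \<open>The constant is isolated so that the duplication identity can turn it into that
    of \<open>?B\<close>.\<close>
  have "?A = of_real (sqrt pi * 2 powr ((3 - real n) / 2) / Gamma ((real n - 2) / 2)) *
     (of_real pi * (\<Prod>k=1..n-3. \<rho> + of_nat k) * of_real ((1 - \<xi>\<^sup>2) powr ((3 - real n) / 4))
       / sin (of_real pi * \<rho>) * ?P)"
    by (simp add: mult_ac)
  also have "\<dots> = ?B"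
    unfolding Gamma_half_duplication[OF assms(1)] by (simp add: mult_ac)
  finally show ?thesis
    using B int by simp
qed

end
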